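(* Let $f$ be an exact symplectic $C^1$ twist map of $\mathbb{A}$ and let $\mu$ be an irrational Mather measure of $f$ which is non uniformly hyperbolic, i.e. the Lyapunov exponents of $\mu$ are non-zero but the corresponding Aubry-Mather set $M=\operatorname{supp}\mu$ is not (uniformly) hyperbolic. Then there exists a dense $G_\delta$ subset $\mathcal{G}$ of $M$ such that $M$ is $C^1$-regular at every point of $\mathcal{G}$.
   Context: $\mathbb{T}=\mathbb{R}/\mathbb{Z}$, $\mathbb{A}=\mathbb{T}\times\mathbb{R}$ with coordinates $(\theta,r)$, symplectic form $d\theta\wedge dr$ and its usual Riemannian metric. $\pi:\mathbb{A}\to\mathbb{T}$ is the first projection, $\tilde\pi:\mathbb{R}^2\to\mathbb{R}$ its lift, $p:\mathbb{R}^2\to\mathbb{A}$ the universal covering. A $C^1$ diffeomorphism $f:\mathbb{A}\to\mathbb{A}$ isotopic to the identity is a positive twist map if, for any lift $\tilde f:\mathbb{R}^2\to\mathbb{R}^2$ and every $\tilde\theta\in\mathbb{R}$, the maps $r\mapsto\tilde\pi\circ\tilde f(\tilde\theta,r)$ and $r\mapsto\tilde\pi\circ\tilde f^{-1}(\tilde\theta,r)$ are both diffeomorphisms (of $\mathbb{R}$), the first increasing and the second decreasing. If $f$ is a positive twist map, $f^{-1}$ is a negative twist map. A twist map may be positive or negative. $f$ is exact symplectic if the 1-form $f^*(r\,d\theta)-r\,d\theta$ is exact. A non-empty set $M\subset\mathbb{A}$ is $f$-ordered if it is compact, $f$-invariant, and for all $z,z'\in p^{-1}(M)$: $\tilde\pi(z)<\tilde\pi(z')\Leftrightarrow\tilde\pi(\tilde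 f(z))<\tilde\pi(\tilde f(z'))$. An Aubry-Mather set of $f$ is a minimal (for inclusion) $f$-ordered set. For an Aubry-Mather set $M$ there is a bi-Lipschitz orientation preserving homeomorphism $h$ of $\mathbb{T}$ with $\pi\circ f(\theta,r)=h(\theta)$ for all $(\theta,r)\in M$; the rotation number $\rho(M,\tilde f)$ is that of a lift $\tilde h$ of $h$ with $\tilde h(\tilde\theta)=\tilde\pi\circ\tilde f(\tilde\theta,r)$ on $p^{-1}(M)$. $M$ is irrational if $\rho(M,\tilde f)$ is irrational. Each Aubry-Mather set $M$ carries a unique $f$-invariant Borel probability measure $\mu(M,f)$; it is ergodic with support $M$. Such a measure is called a Mather measure, irrational if $M$ is irrational. The Lyapunov exponents of an (ergodic) Mather measure $\mu$ are those of the cocycle $Df$ over $(f,\mu)$. For $M\subset\mathbb{A}$ and $x\in M$, the paratingent cone $P_M(x)\subset T_x\mathbb{A}$ is the set of limits $v=\lim_{n\to\infty}\frac{x_n-y_n}{t_n}$ where $(x_n),(y_n)$ are sequences in $M$ converging to $x$, $(t_n)$ is a sequence of positive reals converging to $0$, and $x_n-y_n$ denotes the lift in $[-\frac12,\frac12[^2\subset\mathbb{R}^2$. $M$ is $C^1$-regular at $x$ if there is a line $D$ of $T_x\mathbb{A}$ with $P_M(x)\subset D$. A compact $f$-invariant set is uniformly hyperbolic if it is a hyperbolic set in the usual sense: there is a $Df$-invariant continuous splitting $T_x\mathbb{A}=E^s(x)\oplus E^u(x)$ over it with $Df^n|_{E^s}$ and $Df^{-n}|_{E^u}$ ($n\ge0$)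 uniformly exponentially contracting. *)

theory Defs
  imports "HOL-Probability.Probability"
begin

section \<open>The annulus\<close>

quotient_type circle = real / "\<lambda>x y :: real. x - y \<in> \<int>"
proof (rule equivpI)
  show "reflp (\<lambda>x y :: real. x - y \<in> \<int>)"
    by (simp add: reflp_def)
  show "symp (\<lambda>x y :: real. x - y \<in> \<int>)"
    by (rule sympI) (use Ints_minus in fastforce)
  show "transp (\<lambda>x y :: real. x - y \<in> \<int>)"
    by (rule transpI) (use Ints_add in fastforce)
qed

lift_definition circle_proj :: "real \<Rightarrow> circle" is "\<lambda>x. x" .

text \<open>The representative of \<open>a - b\<close> in \<open>[-1/2, 1/2[\<close>; recall \<open>round x = \<lfloor>x + 1/2\<rfloor>\<close>.\<close>

lift_definition circle_diff :: "circle \<Rightarrow> circle \<Rightarrow> real"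
  is "\<lambda>x y. (x - y) - of_int (round (x - y))"
proof -
  fix x x' y y' :: real
  assume "x - x' \<in> \<int>" "y - y' \<in> \<int>"
  then obtain i j where "x - x' = of_int i" "y - y' = of_int j"
    by (elim Ints_cases)
  then have k: "x - y = (x' - y') + of_int (i - j)"
    by linarith
  have "round (x - y) = round (x' - y') + (i - j)"
    unfolding round_def k by linarith
  with k show "(x - y) - of_int (round (x - y)) = (x' - y') - of_int (round (x' - y'))"
    by linarith
qed

instantiation circle :: metric_space
begin

definition dist_circle :: "circle \<Rightarrow> circle \<Rightarrow> real"
  where "dist_circle a b = \<bar>circle_diff a b\<bar>"

definition uniformity_circle :: "(circle \<times> circle) filter"
  where "uniformity_circle = (INF e\<in>{0 <..}. principal {(x, y). dist x y < e})"

definition open_circle :: "circle set \<Rightarrow> bool"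
  where "open_circle U = (\<forall>x\<in>U. \<forall>\<^sub>F (x', y) in uniformity. x' = x \<longrightarrow> y \<in> U)"

instance
proof
  fix a b c :: circle
  show "dist a b = 0 \<longleftrightarrow> a = b"
    unfolding dist_circle_def
  proof transfer
    fix x y :: real
    show "\<bar>x - y - of_int (round (x - y))\<bar> = 0 \<longleftrightarrow> x - y \<in> \<int>"
    proof
      assume "\<bar>x - y - of_int (round (x - y))\<bar> = 0"
      then have "x - y = of_int (round (x - y))"
        by linarith
      then show "x - y \<in> \<int>"
        by (metis Ints_of_int)
    next
      assume "x - y \<in> \<int>"
      then obtain k where "x - y = of_int k"
        by (rule Ints_cases)
      then show "\<bar>x - y - of_int (round (x - y))\<bar> = 0"
        by (simp only: round_of_int)
    qed
  qed
  show "dist a b \<le> dist a c + dist b c"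
    unfolding dist_circle_def
  proof transfer
    fix x y z :: real
    have "\<bar>(x - y) - of_int (round (x - y))\<bar>
        \<le> \<bar>(x - y) - of_int (round (x - z) - round (y - z))\<bar>"
      by (rule round_diff_minimal)
    also have "\<dots> \<le> \<bar>(x - z) - of_int (round (x - z))\<bar> + \<bar>(y - z) - of_int (round (y - z))\<bar>"
      by simp
    finally show "\<bar>x - y - of_int (round (x - y))\<bar>
        \<le> \<bar>x - z - of_int (round (x - z))\<bar> + \<bar>y - z - of_int (round (y - z))\<bar>" .
  qed
qed (simp_all add: uniformity_circle_def open_circle_def)

end

type_synonym annulus = "circle \<times> real"

definition annulus_proj :: "real \<times> real \<Rightarrow> annulus"
  where "annulus_proj z = (circle_proj (fst z), snd z)"

definition annulus_diff :: "annulus \<Rightarrow> annulus \<Rightarrow> real \<times> real"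
  where "annulus_diff x y = (circle_diff (fst x) (fst y), snd x - snd y)"

section \<open>Lifts, derivatives and diffeomorphisms\<close>

definition is_lift :: "(real \<times> real \<Rightarrow> real \<times> real) \<Rightarrow> (annulus \<Rightarrow> annulus) \<Rightarrow> bool"
  where "is_lift F f \<longleftrightarrow> continuous_on UNIV F \<and> (\<forall>z. annulus_proj (F z) = f (annulus_proj z))"

definition C1_map :: "('a::real_normed_vector \<Rightarrow> 'b::real_normed_vector) \<Rightarrow> bool"
  where "C1_map g \<longleftrightarrow>
    (\<exists>g' :: 'a \<Rightarrow> 'a \<Rightarrow>\<^sub>L 'b. (\<forall>x. (g has_derivative blinfun_apply (g' x)) (at x)) \<and>
      continuous_on UNIV g')"

definition C1_diffeo :: "('a::real_normed_vector \<Rightarrow> 'b::real_normed_vector) \<Rightarrow> bool"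
  where "C1_diffeo g \<longleftrightarrow> bij g \<and> C1_map g \<and> C1_map (inv g)"

text \<open>
  The covering projection is a local diffeomorphism and every continuous self-map of the annulus
  has a continuous lift, so a self-map of the annulus is \<open>C\<^sup>1\<close> iff it has a \<open>C\<^sup>1\<close> lift.
\<close>

definition annulus_C1_map :: "(annulus \<Rightarrow> annulus) \<Rightarrow> bool"
  where "annulus_C1_map f \<longleftrightarrow> (\<exists>F. is_lift F f \<and> C1_map F)"

definition annulus_C1_diffeo :: "(annulus \<Rightarrow> annulus) \<Rightarrow> bool"
  where "annulus_C1_diffeo f \<longleftrightarrow> bij f \<and> annulus_C1_map f \<and> annulus_C1_map (inv f)"

text \<open>
  The differential of \<open>f\<close> at \<open>x\<close>, with every tangent space of the annulus identified with
  \<open>\<real>\<^sup>2\<close>. Two lifts of \<open>f\<close> differ by a constant, and the differential of a lift is invariant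
  under \<open>(\<theta>, r) \<mapsto> (\<theta> + 1, r)\<close>, so neither choice matters.
\<close>

definition annulus_deriv :: "(annulus \<Rightarrow> annulus) \<Rightarrow> annulus \<Rightarrow> real \<times> real \<Rightarrow> real \<times> real"
  where "annulus_deriv f x =
    frechet_derivative (SOME F. is_lift F f) (at (SOME z. annulus_proj z = x))"

definition isotopic_to_id :: "('a::topological_space \<Rightarrow> 'a) \<Rightarrow> bool"
  where "isotopic_to_id f \<longleftrightarrow>
    homotopic_with_canon (\<lambda>h. \<exists>g. homeomorphism UNIV UNIV h g) UNIV UNIV id f"

section \<open>Exact symplectic twist maps\<close>

definition positive_twist_map :: "(annulus \<Rightarrow> annulus) \<Rightarrow> bool"
  where "positive_twist_map f \<longleftrightarrow> annulus_C1_diffeo f \<and> isotopic_to_id f \<and>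
    (\<forall>F. is_lift F f \<longrightarrow>
      (\<forall>\<theta>. C1_diffeo (\<lambda>r. fst (F (\<theta>, r))) \<and> strict_mono (\<lambda>r. fst (F (\<theta>, r))) \<and>
           C1_diffeo (\<lambda>r. fst (inv F (\<theta>, r))) \<and> monotone (<) (>) (\<lambda>r. fst (inv F (\<theta>, r)))))"

text \<open>The inverse of a \<open>C\<^sup>1\<close> diffeomorphism is again one; \<open>bij f\<close> makes \<open>inv f\<close> its inverse.\<close>

definition negative_twist_map :: "(annulus \<Rightarrow> annulus) \<Rightarrow> bool"
  where "negative_twist_map f \<longleftrightarrow> bij f \<and> positive_twist_map (inv f)"

definition twist_map :: "(annulus \<Rightarrow> annulus) \<Rightarrow> bool"
  where "twist_map f \<longleftrightarrow> positive_twist_map f \<or> negative_twist_map f"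

text \<open>\<open>f\<^sup>*(r d\<theta>) - r d\<theta> = dS\<close>, with \<open>dS\<close> computed on the universal cover.\<close>

definition exact_symplectic :: "(annulus \<Rightarrow> annulus) \<Rightarrow> bool"
  where "exact_symplectic f \<longleftrightarrow>
    (\<exists>S :: annulus \<Rightarrow> real. \<forall>z.
      ((\<lambda>w. S (annulus_proj w)) has_derivative
        (\<lambda>v. snd (f (annulus_proj z)) * fst (annulus_deriv f (annulus_proj z) v) - snd z * fst v))
      (at z))"

section \<open>Aubry-Mather sets and Mather measures\<close>

definition ordered_set :: "(annulus \<Rightarrow> annulus) \<Rightarrow> annulus set \<Rightarrow> bool"
  where "ordered_set f M \<longleftrightarrow> M \<noteq> {} \<and> compact M \<and> f ` M = M \<and>
    (\<forall>F. is_lift F f \<longrightarrow>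
      (\<forall>z \<in> annulus_proj -` M. \<forall>z' \<in> annulus_proj -` M.
        fst z < fst z' \<longleftrightarrow> fst (F z) < fst (F z')))"

definition aubry_mather_set :: "(annulus \<Rightarrow> annulus) \<Rightarrow> annulus set \<Rightarrow> bool"
  where "aubry_mather_set f M \<longleftrightarrow> ordered_set f M \<and> (\<forall>N. ordered_set f N \<and> N \<subseteq> M \<longrightarrow> N = M)"

definition bilipschitz_homeo :: "('a::metric_space \<Rightarrow> 'b::metric_space) \<Rightarrow> bool"
  where "bilipschitz_homeo h \<longleftrightarrow>
    bij h \<and> (\<exists>L. L-lipschitz_on UNIV h) \<and> (\<exists>L. L-lipschitz_on UNIV (inv h))"

definition is_circle_lift :: "(real \<Rightarrow> real) \<Rightarrow> (circle \<Rightarrow> circle) \<Rightarrow> bool"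
  where "is_circle_lift H h \<longleftrightarrow>
    continuous_on UNIV H \<and> (\<forall>t. circle_proj (H t) = h (circle_proj t))"

definition has_translation_number :: "(real \<Rightarrow> real) \<Rightarrow> real \<Rightarrow> bool"
  where "has_translation_number H \<rho> \<longleftrightarrow>
    (\<forall>t. (\<lambda>n. ((H ^^ n) t - t) / real n) \<longlonglongrightarrow> \<rho>)"

text \<open>
  \<open>\<rho>\<close> is the rotation number \<open>\<rho>(M, F)\<close>, where \<open>F\<close> is a lift of \<open>f\<close>. The homeomorphism \<open>h\<close> is
  determined only on the projection of \<open>M\<close>, but \<open>\<rho>\<close> does not depend on its choice. As \<open>h\<close> is
  bijective, it preserves orientation iff its lift \<open>H\<close> is increasing.
\<close>

definition has_rotation_number ::
    "(annulus \<Rightarrow> annulus) \<Rightarrow> (real \<times> real \<Rightarrow> real \<times> real) \<Rightarrow> annulus set \<Rightarrow> real \<Rightarrow> bool"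
  where "has_rotation_number f F M \<rho> \<longleftrightarrow>
    (\<exists>h H. bilipschitz_homeo h \<and> (\<forall>x\<in>M. fst (f x) = h (fst x)) \<and>
      is_circle_lift H h \<and> strict_mono H \<and>
      (\<forall>z \<in> annulus_proj -` M. H (fst z) = fst (F z)) \<and>
      has_translation_number H \<rho>)"

text \<open>Changing \<open>F\<close> changes \<open>\<rho>(M, F)\<close> by an integer.\<close>

definition irrational_set :: "(annulus \<Rightarrow> annulus) \<Rightarrow> annulus set \<Rightarrow> bool"
  where "irrational_set f M \<longleftrightarrow>
    (\<exists>F \<rho>. is_lift F f \<and> has_rotation_number f F M \<rho> \<and> \<rho> \<notin> \<rat>)"

definition invariant_probability_on ::
    "(annulus \<Rightarrow> annulus) \<Rightarrow> annulus set \<Rightarrow> annulus measure \<Rightarrow> bool"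
  where "invariant_probability_on f M \<mu> \<longleftrightarrow>
    prob_space \<mu> \<and> sets \<mu> = sets borel \<and> distr \<mu> borel f = \<mu> \<and> emeasure \<mu> M = 1"

definition irrational_mather_measure :: "(annulus \<Rightarrow> annulus) \<Rightarrow> annulus measure \<Rightarrow> bool"
  where "irrational_mather_measure f \<mu> \<longleftrightarrow>
    (\<exists>M. aubry_mather_set f M \<and> irrational_set f M \<and> invariant_probability_on f M \<mu>)"

definition measure_support :: "'a::topological_space measure \<Rightarrow> 'a set"
  where "measure_support \<mu> = {x. \<forall>U. open U \<and> x \<in> U \<longrightarrow> emeasure \<mu> U > 0}"

section \<open>Lyapunov exponents and hyperbolicity\<close>

text \<open>
  For an ergodic measure, these are the almost everywhere constant exponents of the Oseledets
  theorem: for almost every \<open>x\<close> the limits below exist for all \<open>v \<noteq> 0\<close>, and the exponents are the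
  values they take.
\<close>

definition lyapunov_exponents :: "(annulus \<Rightarrow> annulus) \<Rightarrow> annulus measure \<Rightarrow> real set"
  where "lyapunov_exponents f \<mu> =
    {l. AE x in \<mu>. \<exists>v. v \<noteq> 0 \<and> (\<lambda>n. ln (norm (annulus_deriv (f ^^ n) x v)) / real n) \<longlonglongrightarrow> l}"

text \<open>
  Continuity of the splitting is continuity of \<open>P\<close>, where \<open>P x\<close> is the projection onto \<open>Es x\<close>
  along \<open>Eu x\<close>.
\<close>

definition uniformly_hyperbolic :: "(annulus \<Rightarrow> annulus) \<Rightarrow> annulus set \<Rightarrow> bool"
  where "uniformly_hyperbolic f K \<longleftrightarrow> compact K \<and> f ` K = K \<and>
    (\<exists>(Es :: annulus \<Rightarrow> (real \<times> real) set) (Eu :: annulus \<Rightarrow> (real \<times> real) set)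
      (P :: annulus \<Rightarrow> (real \<times> real) \<Rightarrow>\<^sub>L (real \<times> real)) (C :: real) (c :: real).
      continuous_on K P \<and> C > 0 \<and> 0 < c \<and> c < 1 \<and>
      (\<forall>x\<in>K. subspace (Es x) \<and> subspace (Eu x) \<and>
        Es x \<inter> Eu x = {0} \<and> {v + w | v w. v \<in> Es x \<and> w \<in> Eu x} = UNIV \<and>
        (\<forall>v\<in>Es x. P x v = v) \<and> (\<forall>v\<in>Eu x. P x v = 0) \<and>
        annulus_deriv f x ` Es x = Es (f x) \<and> annulus_deriv f x ` Eu x = Eu (f x) \<and>
        (\<forall>n. \<forall>v\<in>Es x. norm (annulus_deriv (f ^^ n) x v) \<le> C * c ^ n * norm v) \<and>
        (\<forall>n. \<forall>v\<in>Eu x. norm (annulus_deriv (inv f ^^ n) x v) \<le> C * c ^ n * norm v)))"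

section \<open>Paratingent cones\<close>

text \<open>
  The second coordinate of \<open>annulus_diff\<close> is not restricted to \<open>[-1/2, 1/2[\<close>; this is immaterial,
  since both sequences converge to \<open>x\<close>.
\<close>

definition paratingent_cone :: "annulus set \<Rightarrow> annulus \<Rightarrow> (real \<times> real) set"
  where "paratingent_cone M x =
    {v. \<exists>(X :: nat \<Rightarrow> annulus) (Y :: nat \<Rightarrow> annulus) (t :: nat \<Rightarrow> real).
      (\<forall>n. X n \<in> M \<and> Y n \<in> M \<and> t n > 0) \<and> X \<longlonglongrightarrow> x \<and> Y \<longlonglongrightarrow> x \<and> t \<longlonglongrightarrow> 0 \<and>
      (\<lambda>n. annulus_diff (X n) (Y n) /\<^sub>R t n) \<longlonglongrightarrow> v}"

definition C1_regular_at :: "annulus set \<Rightarrow> annulus \<Rightarrow> bool"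
  where "C1_regular_at M x \<longleftrightarrow> (\<exists>D. subspace D \<and> dim D = 1 \<and> paratingent_cone M x \<subseteq> D)"

end

theory Submission imports Defs begin

text \<open>
  For \<open>x \<in> M\<close> let \<open>C(x)\<close> be the closed convex cone of the tangent vectors whose images under all
  iterates of \<open>Df\<close>, forward and backward, have first coordinate \<open>\<ge> 0\<close>. Iterates of \<open>f\<close> preserve the
  order of \<open>M\<close>, so the paratingent cone lies in \<open>C(x) \<union> - C(x)\<close>. By the twist condition a nonzero
  vector of \<open>C(x)\<close> is never vertical, so \<open>C(x)\<close> is described by a compact interval of slopes
  \<open>[lo x, hi x]\<close>, and it depends upper semicontinuously on \<open>x\<close>. Hence the points whose interval has at
  most one element form an invariant \<open>G\<^sub>\<delta>\<close> set, at which \<open>M\<close> is regular. If it is nonempty, it is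
  dense by minimality.

  If it is empty, then \<open>width = hi - lo\<close> is positive and, by Baire and minimality, bounded below on
  \<open>M\<close>. With \<open>A(1, hi) = \<alpha>\<^sub>+ (1, hi \<circ> f)\<close> and \<open>A(1, lo) = \<alpha>\<^sub>- (1, lo \<circ> f)\<close>, area preservation gives
  \<open>\<alpha>\<^sub>+ \<alpha>\<^sub>- (width \<circ> f) = width\<close> and the twist gives \<open>\<alpha>\<^sub>+ \<ge> q \<alpha>\<^sub>-\<close> with a uniform \<open>q > 1\<close>. So the quadratic
  form \<open>u\<^sup>2 width\<close> of \<open>u (1, lo)\<close> is contracted by \<open>q\<close> at each step and that of \<open>u (1, hi)\<close> is expanded:
  \<open>M\<close> would be uniformly hyperbolic.
\<close>

section \<open>Cocycles with the twist property\<close>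

text \<open>The differential is treated abstractly, as mutually inverse 2x2 cocycles
  \<open>A\<close> over \<open>f\<close> and \<open>B\<close> over \<open>g\<close> with determinant
  1. The annulus matters only where this pair is produced and where difference quotients are placed
  in the cone. Apart from the sign of the twist nothing distinguishes \<open>f\<close> from
  \<open>g\<close>, so a negative twist map is handled through its inverse, with stable and unstable
  directions exchanged. Two points need care. The extreme slopes are a priori only semicontinuous,
  so the lines they span form a continuous splitting only once uniform rates are known: a limit of
  contracted slopes is contracted at the same rate, and only one slope of the cone can be. Moreover
  \<open>f\<close> is merely C1, so the pullback of r dtheta has coefficients that need not be
  differentiable and its exterior derivative cannot be taken. That Df has determinant 1 is obtained
  point by point, after subtracting an exact form that makes the remaining one differentiable at the
  chosen point.\<close>

primrec cocycle_pow :: "('a \<Rightarrow> 'a) \<Rightarrow> ('a \<Rightarrow> 'v \<Rightarrow> 'v) \<Rightarrow> nat \<Rightarrow> 'a \<Rightarrow> 'v \<Rightarrow> 'v" where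
  "cocycle_pow f A 0 x v = v"
| "cocycle_pow f A (Suc n) x v = cocycle_pow f A n (f x) (A x v)"

definition positive_cone ::
    "('a \<Rightarrow> 'a) \<Rightarrow> ('a \<Rightarrow> 'a) \<Rightarrow> ('a \<Rightarrow> real \<times> real \<Rightarrow> real \<times> real) \<Rightarrow>
      ('a \<Rightarrow> real \<times> real \<Rightarrow> real \<times> real) \<Rightarrow> 'a \<Rightarrow> (real \<times> real) set"
  where "positive_cone f g A B x =
    {v. \<forall>n. 0 \<le> fst (cocycle_pow f A n x v) \<and> 0 \<le> fst (cocycle_pow g B n x v)}"

text \<open>Invariance under \<open>B\<close> is recorded next to invariance under \<open>A\<close>,
  so that the notion is symmetric under exchanging \<open>(f, A, Es)\<close> with
  \<open>(g, B, Eu)\<close>. \<open>P\<close> is the projection at the single point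
  \<open>x\<close>.\<close>

definition hyperbolic_splitting ::
    "('a \<Rightarrow> 'a) \<Rightarrow> ('a \<Rightarrow> 'a) \<Rightarrow> ('a \<Rightarrow> real \<times> real \<Rightarrow> real \<times> real) \<Rightarrow>
      ('a \<Rightarrow> real \<times> real \<Rightarrow> real \<times> real) \<Rightarrow> real \<Rightarrow> real \<Rightarrow>
      ('a \<Rightarrow> (real \<times> real) set) \<Rightarrow> ('a \<Rightarrow> (real \<times> real) set) \<Rightarrow> ((real \<times> real) \<Rightarrow>\<^sub>L (real \<times> real)) \<Rightarrow> 'a \<Rightarrow>
          bool"
  where "hyperbolic_splitting f g A B C c Es Eu P x \<longleftrightarrow>
    subspace (Es x) \<and> subspace (Eu x) \<and>
    Es x \<inter> Eu x = {0} \<and> {v + w | v w. v \<in> Es x \<and> w \<in> Eu x} = UNIV \<and>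
    (\<forall>v\<in>Es x. blinfun_apply P v = v) \<and> (\<forall>v\<in>Eu x. blinfun_apply P v = 0) \<and>
    A x ` Es x = Es (f x) \<and> A x ` Eu x = Eu (f x) \<and>
    B x ` Es x = Es (g x) \<and> B x ` Eu x = Eu (g x) \<and>
    (\<forall>n. \<forall>v\<in>Es x. norm (cocycle_pow f A n x v) \<le> C * c ^ n * norm v) \<and>
    (\<forall>n. \<forall>v\<in>Eu x. norm (cocycle_pow g B n x v) \<le> C * c ^ n * norm v)"

text \<open>Continuity of the projections is asked vector by vector; in finite dimension this is the
  same as continuity in the operator norm.\<close>

definition hyperbolic_cocycle ::
    "'a::metric_space set \<Rightarrow> ('a \<Rightarrow> 'a) \<Rightarrow> ('a \<Rightarrow> 'a) \<Rightarrow> ('a \<Rightarrow> real \<times> real \<Rightarrow> real \<times> real) \<Rightarrow>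
      ('a \<Rightarrow> real \<times> real \<Rightarrow> real \<times> real) \<Rightarrow> bool"
  where "hyperbolic_cocycle K f g A B \<longleftrightarrow>
    (\<exists>Es Eu P C c. (\<forall>v. continuous_on K (\<lambda>x. blinfun_apply (P x) v)) \<and> 0 < C \<and> 0 < c \<and> c < 1 \<and>
      (\<forall>x\<in>K. hyperbolic_splitting f g A B C c Es Eu (P x) x))"

lemma hyperbolic_splitting_swap:
  assumes "hyperbolic_splitting f g A B C c Es Eu P x"
  shows "hyperbolic_splitting g f B A C c Eu Es (id_blinfun - P) x"
proof -
  have "{v + w | v w. v \<in> Eu x \<and> w \<in> Es x} = {v + w | v w. v \<in> Es x \<and> w \<in> Eu x}"
    by (metis (no_types, opaque_lifting) add.commute)
  with assms show ?thesis
    unfolding hyperbolic_splitting_def by (simp add: blinfun.diff_left Int_commute)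
qed

lemma hyperbolic_cocycle_swap:
  assumes "hyperbolic_cocycle K f g A B"
  shows "hyperbolic_cocycle K g f B A"
proof -
  obtain Es Eu P C c where P: "\<And>v. continuous_on K (\<lambda>x. blinfun_apply (P x) v)"
    and C: "0 < C" "0 < c" "c < 1"
    and split: "\<And>x. x \<in> K \<Longrightarrow> hyperbolic_splitting f g A B C c Es Eu (P x) x"
    using assms unfolding hyperbolic_cocycle_def by blast
  have "continuous_on K (\<lambda>x. blinfun_apply (id_blinfun - P x) v)" for v
    unfolding blinfun.diff_left by (intro continuous_intros P)
  then show ?thesis
    unfolding hyperbolic_cocycle_def using C hyperbolic_splitting_swap[OF split]
    by (intro exI[of _ Eu] exI[of _ Es] exI[of _
        "\<lambda>x. id_blinfun - P x"] exI[of _ C] exI[of _ c]) simp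
qed

text \<open>\<open>A x\<close> has rows (a, b) and (c, d). The condition \<open>b_pos\<close> is the
  infinitesimal twist: the upward vertical vector is pushed to the right. \<open>B\<close> is given
  abstractly as the inverse cocycle; determinant 1 makes it the adjugate matrix.\<close>

locale twist_cocycle =
  fixes M :: "'a::metric_space set" and f g :: "'a \<Rightarrow> 'a"
    and A B :: "'a \<Rightarrow> real \<times> real \<Rightarrow> real \<times> real" and a b c d :: "'a \<Rightarrow> real"
  assumes compact_M: "compact M" and M_nonempty: "M \<noteq> {}"
    and f_M: "x \<in> M \<Longrightarrow> f x \<in> M" and g_M: "x \<in> M \<Longrightarrow> g x \<in> M"
    and gf: "x \<in> M \<Longrightarrow> g (f x) = x" and fg: "x \<in> M \<Longrightarrow> f (g x) = x"
    and continuous_f: "continuous_on M f" and continuous_g: "continuous_on M g"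
    and continuous_entries: "continuous_on M a" "continuous_on M b" "continuous_on M c"
        "continuous_on M d"
    and A_eq: "x \<in> M \<Longrightarrow> A x v = (a x * fst v + b x * snd v, c x * fst v + d x * snd v)"
    and BA: "x \<in> M \<Longrightarrow> B (f x) (A x v) = v"
    and det_eq_1: "x \<in> M \<Longrightarrow> a x * d x - b x * c x = 1"
    and b_pos: "x \<in> M \<Longrightarrow> 0 < b x"
begin

abbreviation "Apow \<equiv> cocycle_pow f A"
abbreviation "Bpow \<equiv> cocycle_pow g B"
abbreviation "Cone \<equiv> positive_cone f g A B"

lemma B_f_eq:
  assumes "x \<in> M"
  shows "B (f x) v = (d x * fst v - b x * snd v, a x * snd v - c x * fst v)"
proof -
  let ?w = "(d x * fst v - b x * snd v, a x * snd v - c x * fst v)"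
  have "A x ?w = ((a x * d x - b x * c x) * fst v, (a x * d x - b x * c x) * snd v)"
    using assms by (simp add: A_eq algebra_simps)
  also have "\<dots> = v"
    using det_eq_1[OF assms] by simp
  finally show ?thesis
    using BA[OF assms, of ?w] by simp
qed

lemma B_eq:
  assumes "x \<in> M"
  shows "B x v = (d (g x) * fst v - b (g x) * snd v, a (g x) * snd v - c (g x) * fst v)"
  using B_f_eq[OF g_M[OF assms], of v] fg[OF assms] by simp

lemma AB:
  assumes "x \<in> M"
  shows "A x (B (f x) v) = v"
proof -
  have "A x (B (f x) v) = ((a x * d x - b x * c x) * fst v, (a x * d x - b x * c x) * snd v)"
    using assms by (simp add: A_eq B_f_eq algebra_simps)
  then show ?thesis
    using det_eq_1[OF assms] by simp
qed

lemma A_add: "x \<in> M \<Longrightarrow> A x (v + w) = A x v + A x w"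
  and A_scaleR: "x \<in> M \<Longrightarrow> A x (t *\<^sub>R v) = t *\<^sub>R A x v"
  by (simp_all add: A_eq algebra_simps)

lemma B_add: "x \<in> M \<Longrightarrow> B x (v + w) = B x v + B x w"
  and B_scaleR: "x \<in> M \<Longrightarrow> B x (t *\<^sub>R v) = t *\<^sub>R B x v"
  by (simp_all add: B_eq algebra_simps)

lemma Apow_add: "x \<in> M \<Longrightarrow> Apow n x (v + w) = Apow n x v + Apow n x w"
  by (induction n arbitrary: x v w) (simp_all add: A_add f_M)

lemma Apow_scaleR: "x \<in> M \<Longrightarrow> Apow n x (t *\<^sub>R v) = t *\<^sub>R Apow n x v"
  by (induction n arbitrary: x v) (simp_all add: A_scaleR f_M)

lemma Bpow_scaleR: "x \<in> M \<Longrightarrow> Bpow n x (t *\<^sub>R v) = t *\<^sub>R Bpow n x v"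
  by (induction n arbitrary: x v) (simp_all add: B_scaleR g_M)

lemma tendsto_on_M:
  "continuous_on M h \<Longrightarrow> (\<And>n. X n \<in> M) \<Longrightarrow> x \<in> M \<Longrightarrow> X \<longlonglongrightarrow> x \<Longrightarrow> (\<lambda>n. h (X n)) \<longlonglongrightarrow> h x"
  by (rule continuous_on_tendsto_compose) auto

lemma tendsto_Apow:
  assumes "\<And>n. X n \<in> M" "x \<in> M" "X \<longlonglongrightarrow> x" "V \<longlonglongrightarrow> v"
  shows "(\<lambda>n. Apow k (X n) (V n)) \<longlonglongrightarrow> Apow k x v"
  using assms
proof (induction k arbitrary: X x V v)
  case (Suc k)
  have "(\<lambda>n. A (X n) (V n)) \<longlonglongrightarrow> A x v"
    using Suc.prems by (auto simp: A_eq intro!: tendsto_intros tendsto_on_M[OF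
        continuous_entries(1)]
      tendsto_on_M[OF continuous_entries(2)] tendsto_on_M[OF continuous_entries(3)]
      tendsto_on_M[OF continuous_entries(4)])
  then show ?case
    using Suc.prems by (auto intro!: Suc.IH tendsto_on_M[OF continuous_f] f_M)
qed simp

lemma tendsto_Bpow:
  assumes "\<And>n. X n \<in> M" "x \<in> M" "X \<longlonglongrightarrow> x" "V \<longlonglongrightarrow> v"
  shows "(\<lambda>n. Bpow k (X n) (V n)) \<longlonglongrightarrow> Bpow k x v"
  using assms
proof (induction k arbitrary: X x V v)
  case (Suc k)
  have g: "(\<lambda>n. g (X n)) \<longlonglongrightarrow> g x" "\<And>n. g (X n) \<in> M" "g x \<in> M"
    using Suc.prems by (auto intro: tendsto_on_M[OF continuous_g] g_M)
  have "(\<lambda>n. B (X n) (V n)) \<longlonglongrightarrow> B x v"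
    using Suc.prems(1,2,4) g
    by (auto simp: B_eq intro!: tendsto_intros tendsto_on_M[OF continuous_entries(1)]
      tendsto_on_M[OF continuous_entries(2)] tendsto_on_M[OF continuous_entries(3)]
      tendsto_on_M[OF continuous_entries(4)])
  then show ?case
    using g by (auto intro!: Suc.IH)
qed simp

text \<open>Each defining inequality of the cone is closed and each iterate is continuous in base
  point and vector. This is the upper semicontinuity of the cone.\<close>

lemma cone_closed_graph:
  assumes "\<And>n. X n \<in> M" "x \<in> M" "X \<longlonglongrightarrow> x" "V \<longlonglongrightarrow> v" "\<And>n. V n \<in> Cone (X n)"
  shows "v \<in> Cone x"
proof -
  have "0 \<le> fst (Apow k x v)" for k
    using tendsto_fst[OF tendsto_Apow[OF assms(1-4), of k]] assms(5)
    by (intro LIMSEQ_le_const) (auto simp: positive_cone_def)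
  moreover have "0 \<le> fst (Bpow k x v)" for k
    using tendsto_fst[OF tendsto_Bpow[OF assms(1-4), of k]] assms(5)
    by (intro LIMSEQ_le_const) (auto simp: positive_cone_def)
  ultimately show ?thesis
    by (simp add: positive_cone_def)
qed

lemma cone_A:
  assumes "x \<in> M" "v \<in> Cone x"
  shows "A x v \<in> Cone (f x)"
proof -
  have "0 \<le> fst (Apow n (f x) (A x v))" for n
    using assms(2) unfolding positive_cone_def
        by (metis (mono_tags, lifting) cocycle_pow.simps(2) mem_Collect_eq)
  moreover have "0 \<le> fst (Bpow n (f x) (A x v))" for n
  proof (cases n)
    \<comment> \<open>Shifting along the orbit exchanges one forward condition for one backward
      condition; at time 0 the two are the same.\<close>
    case 0
    then show ?thesis
      using \<open>0 \<le> fst (Apow 0 (f x) (A x v))\<close> by simp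
  next
    case (Suc m)
    then show ?thesis
      using assms by (simp add: BA gf positive_cone_def)
  qed
  ultimately show ?thesis
    by (simp add: positive_cone_def)
qed

lemma cone_B:
  assumes "x \<in> M" "v \<in> Cone (f x)"
  shows "B (f x) v \<in> Cone x"
proof -
  have *: "0 \<le> fst (Bpow n x (B (f x) v))" for n
  proof -
    have "0 \<le> fst (Bpow (Suc n) (f x) v)"
      using assms(2) unfolding positive_cone_def by blast
    then show ?thesis
      using assms(1) by (simp add: gf)
  qed
  moreover have "0 \<le> fst (Apow n x (B (f x) v))" for n
  proof (cases n)
    case 0
    then show ?thesis
      using *[of 0] by simp
  next
    case (Suc m)
    then show ?thesis
      using assms by (simp add: AB positive_cone_def)
  qed
  ultimately show ?thesis
    by (simp add: positive_cone_def)
qed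

lemma cone_scaleR: "x \<in> M \<Longrightarrow> v \<in> Cone x \<Longrightarrow> 0 \<le> t \<Longrightarrow> t *\<^sub>R v \<in> Cone x"
  by (simp add: positive_cone_def Apow_scaleR Bpow_scaleR)

text \<open>The reason for looking in both time directions: \<open>A\<close> pushes a downward
  vertical vector to the left, and \<open>B\<close>, whose upper right entry is
  \<open>- b (g x)\<close>, does so with an upward one.\<close>

lemma cone_fst_pos:
  assumes "x \<in> M" "v \<in> Cone x" "v \<noteq> 0"
  shows "0 < fst v"
proof (rule ccontr)
  assume "\<not> 0 < fst v"
  moreover have n: "0 \<le> fst (Apow n x v) \<and> 0 \<le> fst (Bpow n x v)" for n
    using assms(2) by (simp add: positive_cone_def)
  ultimately have 0: "fst v = 0"
    using n[of 0] by simp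
  have "0 \<le> b x * snd v" "0 \<le> - (b (g x) * snd v)"
    using n[of 1] 0 assms(1) by (simp_all add: A_eq B_eq)
  then have "snd v = 0"
    using b_pos[OF assms(1)] b_pos[OF g_M[OF assms(1)]]
    by (simp add: zero_le_mult_iff mult_le_0_iff)
  with 0 assms(3) show False
    by (simp add: prod_eq_iff)
qed

section \<open>Slopes of the cone and the projective action of the cocycle\<close>

definition slopes :: "'a \<Rightarrow> real set"
  where "slopes x = {s. (1, s) \<in> Cone x}"

text \<open>The Moebius action of \<open>A x\<close> on slopes. Its denominator is the first
  coordinate of \<open>A x (1, s)\<close>, called the multiplier of \<open>s\<close> below.\<close>

definition slope_map :: "'a \<Rightarrow> real \<Rightarrow> real"
  where "slope_map x s = (c x + d x * s) / (a x + b x * s)"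

lemma cone_iff_slopes:
  assumes "x \<in> M" "v \<noteq> 0"
  shows "v \<in> Cone x \<longleftrightarrow> 0 < fst v \<and> snd v / fst v \<in> slopes x"
proof
  assume v: "v \<in> Cone x"
  have pos: "0 < fst v"
    by (rule cone_fst_pos[OF assms(1) v assms(2)])
  then have "(1 / fst v) *\<^sub>R v = (1, snd v / fst v)"
    by (simp add: prod_eq_iff)
  moreover have "(1 / fst v) *\<^sub>R v \<in> Cone x"
    using pos by (intro cone_scaleR assms v) simp
  ultimately show "0 < fst v \<and> snd v / fst v \<in> slopes x"
    using pos by (simp add: slopes_def)
next
  assume *: "0 < fst v \<and> snd v / fst v \<in> slopes x"
  then have "fst v *\<^sub>R (1, snd v / fst v) \<in> Cone x"
    by (intro cone_scaleR assms) (auto simp: slopes_def)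
  moreover have "fst v *\<^sub>R (1, snd v / fst v) = v"
    using * by (simp add: prod_eq_iff)
  ultimately show "v \<in> Cone x"
    by simp
qed

lemma A_nonzero:
  assumes "x \<in> M" "v \<noteq> 0"
  shows "A x v \<noteq> 0"
proof
  assume "A x v = 0"
  then have "B (f x) 0 = v"
    using BA[OF assms(1), of v] by simp
  then show False
    using assms by (simp add: B_f_eq prod_eq_iff)
qed

lemma slope_map_slopes:
  assumes "x \<in> M" "s \<in> slopes x"
  shows "0 < a x + b x * s" "slope_map x s \<in> slopes (f x)"
proof -
  have "A x (1, s) \<in> Cone (f x)" "A x (1, s) \<noteq> 0"
    using assms cone_A A_nonzero[of x "(1, s)"] by (simp_all add: slopes_def zero_prod_def)
  then have "0 < fst (A x (1, s)) \<and> snd (A x (1, s)) / fst (A x (1, s)) \<in> slopes (f x)"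
    using cone_iff_slopes f_M[OF assms(1)] by blast
  then show "0 < a x + b x * s" "slope_map x s \<in> slopes (f x)"
    by (simp_all add: A_eq assms slope_map_def)
qed

lemma A_slope:
  assumes "x \<in> M" "s \<in> slopes x"
  shows "A x (1, s) = (a x + b x * s) *\<^sub>R (1, slope_map x s)"
  using slope_map_slopes(1)[OF assms] by (simp add: A_eq assms slope_map_def prod_eq_iff)

lemma slope_map_surj:
  assumes "x \<in> M" "s' \<in> slopes (f x)"
  obtains s where "s \<in> slopes x" "slope_map x s = s'"
proof -
  define v where "v = B (f x) (1, s')"
  have Av: "A x v = (1, s')"
    using AB[OF assms(1)] by (simp add: v_def)
  then have "v \<noteq> 0"
    using assms(1) by (auto simp: A_eq)
  moreover have "v \<in> Cone x"
    using assms by (simp add: v_def slopes_def cone_B)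
  ultimately have s: "0 < fst v" "snd v / fst v \<in> slopes x"
    using cone_iff_slopes[OF assms(1)] by auto
  have "a x * fst v + b x * snd v = 1" "c x * fst v + d x * snd v = s'"
    using Av by (simp_all add: A_eq assms)
  then have "a x + b x * (snd v / fst v) = 1 / fst v" "c x + d x * (snd v / fst v) = s' / fst v"
    using s(1) by (simp_all add: field_simps)
  then have "slope_map x (snd v / fst v) = s'"
    using s(1) by (simp add: slope_map_def)
  then show thesis
    using s(2) that by blast
qed

lemma slope_map_mult:
  assumes "x \<in> M" "s \<in> slopes x"
  shows "(a x + b x * s) * slope_map x s = c x + d x * s"
  using slope_map_slopes(1)[OF assms] by (simp add: slope_map_def)

text \<open>The left side is the first coordinate of \<open>B (f x)\<close> applied to
  \<open>(1, slope_map x s)\<close>, so the multiplier of the inverse cocycle is the reciprocal one.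
  This turns an upper bound for it into a lower bound for the multiplier.\<close>

lemma multiplier_inverse:
  assumes "x \<in> M" "s \<in> slopes x"
  shows "d x - b x * slope_map x s = 1 / (a x + b x * s)"
proof -
  have "(a x + b x * s) * (d x - b x * slope_map x s) =
    (a x + b x * s) * d x - b x * ((a x + b x * s) * slope_map x s)"
    by (simp add: algebra_simps)
  also have "\<dots> = 1"
    unfolding slope_map_mult[OF assms] using det_eq_1[OF assms(1)] by (simp add: algebra_simps)
  finally show ?thesis
    using slope_map_slopes(1)[OF assms] by (simp add: nonzero_eq_divide_eq mult.commute)
qed

text \<open>Area preservation in slope coordinates: \<open>s' - s\<close> is the oriented area
  spanned by \<open>(1, s)\<close> and \<open>(1, s')\<close>, and \<open>A x\<close> scales these
  vectors to their images by the two multipliers.\<close>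

lemma slope_map_diff:
  assumes "x \<in> M" "s \<in> slopes x" "s' \<in> slopes x"
  shows "(a x + b x * s) * (a x + b x * s') * (slope_map x s' - slope_map x s) = s' - s"
proof -
  have "(a x + b x * s) * (a x + b x * s') * (slope_map x s' - slope_map x s) =
    (a x + b x * s) * ((a x + b x * s') * slope_map x s') -
    (a x + b x * s') * ((a x + b x * s) * slope_map x s)"
    by (simp only: right_diff_distrib mult_ac)
  also have "\<dots> = (a x * d x - b x * c x) * (s' - s)"
    unfolding slope_map_mult[OF assms(1,2)] slope_map_mult[OF assms(1,3)]
    by (simp add: algebra_simps)
  finally show ?thesis
    using det_eq_1[OF assms(1)] by simp
qed

lemma slope_map_mono:
  assumes "x \<in> M" "s \<in> slopes x" "s' \<in> slopes x"
  shows "slope_map x s \<le> slope_map x s' \<longleftrightarrow> s \<le> s'"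
proof -
  have "0 < (a x + b x * s) * (a x + b x * s')"
    using slope_map_slopes(1)[OF assms(1,2)] slope_map_slopes(1)[OF assms(1,3)] by simp
  then have "0 \<le> slope_map x s' - slope_map x s \<longleftrightarrow>
      0 \<le> (a x + b x * s) * (a x + b x * s') * (slope_map x s' - slope_map x s)"
    using mult_le_cancel_left_pos[of _ 0 "slope_map x s' - slope_map x s"] by simp
  then show ?thesis
    by (simp add: slope_map_diff[OF assms])
qed

lemma slopes_closed_graph:
  assumes "\<And>n. X n \<in> M" "x \<in> M" "X \<longlonglongrightarrow> x" "s \<longlonglongrightarrow> t" "\<And>n. s n \<in> slopes (X n)"
  shows "t \<in> slopes x"
  using cone_closed_graph[OF assms(1-3) tendsto_Pair[OF tendsto_const assms(4)]] assms(5)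
  by (simp add: slopes_def)

lemma closed_slopes: "x \<in> M \<Longrightarrow> closed (slopes x)"
  unfolding closed_sequential_limits using slopes_closed_graph[of "\<lambda>_. x" x] by auto

lemma bounded_on_M:
  assumes "continuous_on M (h :: 'a \<Rightarrow> real)"
  obtains L where "0 < L" "\<And>x. x \<in> M \<Longrightarrow> \<bar>h x\<bar> \<le> L"
proof -
  have "bounded (h ` M)"
    by (intro compact_imp_bounded compact_continuous_image assms compact_M)
  then show thesis
    unfolding bounded_pos using that by auto
qed

text \<open>One step each way suffices: the first coordinate of the forward image gives a lower
  bound for \<open>s\<close>, that of the backward image an upper bound. Positivity of
  \<open>b\<close> on the compact set makes both uniform.\<close>

lemma bounded_slopes:
  obtains L where "0 < L" "\<And>x s. x \<in> M \<Longrightarrow> s \<in> slopes x \<Longrightarrow> \<bar>s\<bar> \<le> L"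
proof -
  have nz: "\<forall>x\<in>M. b x \<noteq> 0"
    using b_pos by force
  obtain L1 where L1: "0 < L1" "\<And>x. x \<in> M \<Longrightarrow> \<bar>a x / b x\<bar> \<le> L1"
    using bounded_on_M[OF continuous_on_divide[OF continuous_entries(1,2) nz]] by blast
  obtain L2 where L2: "0 < L2" "\<And>x. x \<in> M \<Longrightarrow> \<bar>d x / b x\<bar> \<le> L2"
    using bounded_on_M[OF continuous_on_divide[OF continuous_entries(4,2) nz]] by blast
  have "\<bar>s\<bar> \<le> L1 + L2" if x: "x \<in> M" and s: "s \<in> slopes x" for x s
  proof -
    have n: "0 \<le> fst (Apow n x (1, s)) \<and> 0 \<le> fst (Bpow n x (1, s))" for n
      using s by (simp add: slopes_def positive_cone_def)
    have "0 \<le> a x + b x * s" "0 \<le> d (g x) - b (g x) * s"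
      using n[of 1] x by (simp_all add: A_eq B_eq)
    then have "- (a x / b x) \<le> s" "s \<le> d (g x) / b (g x)"
      using b_pos[OF x] b_pos[OF g_M[OF x]] by (simp_all add: field_simps)
    then show ?thesis
      using L1(1) L2(1) L1(2)[OF x] L2(2)[OF g_M[OF x]] by linarith
  qed
  then show thesis
    using L1(1) L2(1) that[of "L1 + L2"] by simp
qed

lemma bounded_multiplier:
  obtains K where "0 < K" "\<And>x s. x \<in> M \<Longrightarrow> s \<in> slopes x \<Longrightarrow> a x + b x * s \<le> K"
    "\<And>x s. x \<in> M \<Longrightarrow> s \<in> slopes x \<Longrightarrow> 1 \<le> K * (a x + b x * s)"
proof -
  obtain L where L: "0 < L" "\<And>x s. x \<in> M \<Longrightarrow> s \<in> slopes x \<Longrightarrow> \<bar>s\<bar> \<le> L"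
    using bounded_slopes by blast
  obtain La where La: "0 < La" "\<And>x. x \<in> M \<Longrightarrow> \<bar>a x\<bar> \<le> La"
    using bounded_on_M[OF continuous_entries(1)] by blast
  obtain Lb where Lb: "0 < Lb" "\<And>x. x \<in> M \<Longrightarrow> \<bar>b x\<bar> \<le> Lb"
    using bounded_on_M[OF continuous_entries(2)] by blast
  obtain Ld where Ld: "0 < Ld" "\<And>x. x \<in> M \<Longrightarrow> \<bar>d x\<bar> \<le> Ld"
    using bounded_on_M[OF continuous_entries(4)] by blast
  have bs: "\<bar>b x * s\<bar> \<le> Lb * L" if "x \<in> M" "\<bar>s\<bar> \<le> L" for x s
    unfolding abs_mult using that Lb by (intro mult_mono) auto
  let ?K = "La + Ld + Lb * L"
  have "0 < ?K"
    using L(1) La(1) Lb(1) Ld(1) by (simp add: add_pos_pos)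
  moreover have "a x + b x * s \<le> ?K" if "x \<in> M" "s \<in> slopes x" for x s
    using bs[OF that(1) L(2)[OF that]] La(2)[OF that(1)] Ld(1) by linarith
  moreover have "1 \<le> ?K * (a x + b x * s)" if xs: "x \<in> M" "s \<in> slopes x" for x s
  proof -
    have "\<bar>b x * slope_map x s\<bar> \<le> Lb * L"
      by (intro bs L(2)[OF f_M[OF xs(1)]] slope_map_slopes xs)
    then have "1 / (a x + b x * s) \<le> ?K"
      using Ld(2)[OF xs(1)] La(1) multiplier_inverse[OF xs] by linarith
    then show ?thesis
      using slope_map_slopes(1)[OF xs] by (simp add: field_simps)
  qed
  ultimately show thesis
    using that by blast
qed

text \<open>Stated with pairs of slopes instead of extreme slopes, because \<open>slopes x\<close>
  may be empty here.\<close>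

definition wide :: "real \<Rightarrow> 'a set"
  where "wide e = {x \<in> M. \<exists>s \<in> slopes x. \<exists>s' \<in> slopes x. s + e \<le> s'}"

lemma closed_wide: "closed (wide e)"
  unfolding closed_sequential_limits
proof (intro allI impI, elim conjE)
  fix X x
  assume X: "\<forall>n. X n \<in> wide e" "X \<longlonglongrightarrow> x"
  then have XM: "X n \<in> M" for n
    by (simp add: wide_def)
  have x: "x \<in> M"
    by (rule closed_sequentially[OF compact_imp_closed[OF compact_M] XM X(2)])
  obtain s s' where s: "\<And>n. s n \<in> slopes (X n)" "\<And>n. s' n \<in> slopes (X n)" "\<And>n. s n + e \<le> s' n"
    using X(1) unfolding wide_def by simp metis
  obtain L where L: "\<And>x s. x \<in> M \<Longrightarrow> s \<in> slopes x \<Longrightarrow> \<bar>s\<bar> \<le> L"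
    using bounded_slopes by blast
  have "range (\<lambda>n. (s n, s' n)) \<subseteq> {-L..L} \<times> {-L..L}"
    using L[OF XM s(1)] L[OF XM s(2)] by (auto simp: abs_le_iff minus_le_iff)
  then have "bounded (range (\<lambda>n. (s n, s' n)))"
    by (rule bounded_subset[rotated]) (intro bounded_Times bounded_closed_interval)
  then obtain l r where r: "strict_mono r" "((\<lambda>n. (s n, s' n)) \<circ> r) \<longlonglongrightarrow> l"
    using bounded_imp_convergent_subsequence by blast
  obtain t t' where l: "l = (t, t')"
    by (cases l)
  have t: "(\<lambda>n. s (r n)) \<longlonglongrightarrow> t" "(\<lambda>n. s' (r n)) \<longlonglongrightarrow> t'"
    using tendsto_fst[OF r(2)] tendsto_snd[OF r(2)] by (simp_all add: l o_def)
  have Xr: "(\<lambda>n. X (r n)) \<longlonglongrightarrow> x"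
    using LIMSEQ_subseq_LIMSEQ[OF X(2) r(1)] by (simp add: o_def)
  have "t \<in> slopes x" "t' \<in> slopes x"
    by (rule slopes_closed_graph[OF XM x Xr]; rule t s)+
  moreover have "t + e \<le> t'"
    by (rule LIMSEQ_le[OF tendsto_add[OF t(1) tendsto_const] t(2)]) (use s(3) in auto)
  ultimately show "x \<in> wide e"
    using x unfolding wide_def by blast
qed

end

text \<open>A sequence of values staying away from \<open>h x\<close> would, being bounded, have a
  convergent subsequence, whose limit the closed graph identifies as \<open>h x\<close>.\<close>

lemma continuous_on_closed_graph_bounded:
  fixes h :: "'a::metric_space \<Rightarrow> real"
  assumes "\<And>x. x \<in> S \<Longrightarrow> \<bar>h x\<bar> \<le> L"
    and "\<And>X x t. (\<And>n. X n \<in> S) \<Longrightarrow> x \<in> S \<Longrightarrow> X \<longlonglongrightarrow> x \<Longrightarrow> (\<lambda>n. h (X n)) \<longlonglongrightarrow> t \<Longrightarrow> t = h x"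
  shows "continuous_on S h"
  unfolding continuous_on_sequentially
proof (intro ballI allI impI, elim conjE)
  fix X x
  assume x: "x \<in> S" and X: "\<forall>n. X n \<in> S" "X \<longlonglongrightarrow> x"
  show "(h \<circ> X) \<longlonglongrightarrow> h x"
  proof (rule ccontr)
    assume "\<not> (h \<circ> X) \<longlonglongrightarrow> h x"
    then obtain e where e: "0 < e" "\<not> (\<forall>\<^sub>F n in sequentially. dist ((h \<circ> X) n) (h x) < e)"
      unfolding tendsto_iff by blast
    obtain r :: "nat \<Rightarrow> nat" where r: "strict_mono r" "\<forall>n. \<not> dist ((h \<circ> X) (r n)) (h x) < e"
      using not_eventually_sequentiallyD[OF e(2)] by blast
    have "bounded (range (\<lambda>n. h (X (r n))))"
      unfolding bounded_iff using assms(1) X(1) by auto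
    then obtain l q where q: "strict_mono q" "((\<lambda>n. h (X (r n))) \<circ> q) \<longlonglongrightarrow> l"
      using bounded_imp_convergent_subsequence by blast
    have "(\<lambda>n. X (r (q n))) \<longlonglongrightarrow> x"
      using LIMSEQ_subseq_LIMSEQ[OF X(2) strict_mono_o[OF r(1) q(1)]] by (simp add: o_def)
    then have "l = h x"
      by (rule assms(2)[rotated 2]) (use X(1) x q(2) in \<open>auto simp: o_def\<close>)
    then have "\<forall>\<^sub>F n in sequentially. dist (h (X (r (q n)))) (h x) < e"
      using q(2) e(1) by (simp add: tendsto_iff o_def)
    then show False
      using r(2) by (simp add: o_def eventually_sequentially) blast
  qed
qed

section \<open>Products of multipliers along orbits of an invariant line field\<close>

lemma cocycle_pow_section:
  fixes L :: "'a \<Rightarrow> real \<times> real \<Rightarrow> real \<times> real"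
  assumes "\<And>x. x \<in> K \<Longrightarrow> h x \<in> K"
    and "\<And>x t v. x \<in> K \<Longrightarrow> L x (t *\<^sub>R v) = t *\<^sub>R L x v"
    and "\<And>x. x \<in> K \<Longrightarrow> L x (1, \<sigma> x) = m x *\<^sub>R (1, \<sigma> (h x))"
    and "x \<in> K"
  shows "cocycle_pow h L n x (t *\<^sub>R (1, \<sigma> x)) =
    (t * (\<Prod>i<n. m ((h ^^ i) x))) *\<^sub>R (1, \<sigma> ((h ^^ n) x))"
  using assms(4)
proof (induction n arbitrary: x t)
  case (Suc n)
  have "cocycle_pow h L (Suc n) x (t *\<^sub>R (1, \<sigma> x))
      = cocycle_pow h L n (h x) ((t * m x) *\<^sub>R (1, \<sigma> (h x)))"
    using Suc.prems by (simp add: assms(2,3) del: scaleR_Pair)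
  also have "\<dots> = (t * m x * (\<Prod>i<n. m ((h ^^ i) (h x)))) *\<^sub>R (1, \<sigma> ((h ^^ n) (h x)))"
    by (rule Suc.IH) (rule assms(1)[OF Suc.prems])
  finally show ?case
    by (simp add: prod.lessThan_Suc_shift funpow_swap1 mult.assoc del: prod.lessThan_Suc)
qed simp

text \<open>Iterates a one-step contraction of the quadratic form that takes the value
  \<open>u\<^sup>2 * w x\<close> on \<open>u\<close> times the section at \<open>x\<close>;
  \<open>m\<close> is the multiplier of the section. The next lemma is its expanding
  counterpart.\<close>

lemma prod_orbit_le:
  fixes m w :: "'a \<Rightarrow> real"
  assumes "\<And>x. x \<in> K \<Longrightarrow> h x \<in> K" "0 \<le> q"
    and "\<And>x. x \<in> K \<Longrightarrow> q * (m x)\<^sup>2 * w (h x) \<le> w x" and "x \<in> K"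
  shows "q ^ n * (\<Prod>i<n. m ((h ^^ i) x))\<^sup>2 * w ((h ^^ n) x) \<le> w x"
  using assms(4)
proof (induction n arbitrary: x)
  case (Suc n)
  have "q ^ Suc n * (\<Prod>i<Suc n. m ((h ^^ i) x))\<^sup>2 * w ((h ^^ Suc n) x) =
    (q * (m x)\<^sup>2) * (q ^ n * (\<Prod>i<n. m ((h ^^ i) (h x)))\<^sup>2 * w ((h ^^ n) (h x)))"
    by (simp add: prod.lessThan_Suc_shift funpow_swap1 power_mult_distrib del: prod.lessThan_Suc)
  also have "\<dots> \<le> (q * (m x)\<^sup>2) * w (h x)"
    using assms(2) by (intro mult_left_mono Suc.IH assms(1) Suc.prems) simp
  also have "\<dots> \<le> w x"
    by (rule assms(3)[OF Suc.prems])
  finally show ?case .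
qed simp

lemma prod_orbit_ge:
  fixes m w :: "'a \<Rightarrow> real"
  assumes "\<And>x. x \<in> K \<Longrightarrow> h x \<in> K" "0 \<le> q"
    and "\<And>x. x \<in> K \<Longrightarrow> q * w x \<le> (m x)\<^sup>2 * w (h x)" and "x \<in> K"
  shows "q ^ n * w x \<le> (\<Prod>i<n. m ((h ^^ i) x))\<^sup>2 * w ((h ^^ n) x)"
  using assms(4)
proof (induction n arbitrary: x)
  case (Suc n)
  have "q ^ Suc n * w x = q ^ n * (q * w x)"
    by simp
  also have "\<dots> \<le> q ^ n * ((m x)\<^sup>2 * w (h x))"
    using assms(2) by (intro mult_left_mono assms(3) Suc.prems) simp
  also have "\<dots> = (m x)\<^sup>2 * (q ^ n * w (h x))"
    by simp
  also have "\<dots> \<le> (m x)\<^sup>2 * ((\<Prod>i<n. m ((h ^^ i) (h x)))\<^sup>2 * w ((h ^^ n) (h x)))"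
    by (intro mult_left_mono Suc.IH assms(1) Suc.prems) simp
  finally show ?case
    by (simp add: prod.lessThan_Suc_shift funpow_swap1 power_mult_distrib mult.assoc del:
        prod.lessThan_Suc)
qed simp

lemma limit_in_closure:
  fixes x :: "'a::metric_space"
  assumes "X \<longlonglongrightarrow> x" "\<And>n. X n \<in> S"
  shows "x \<in> closure S"
  unfolding closure_sequential using assms by (intro exI[of _ X]) simp

section \<open>Cones with nonempty interior\<close>

locale wide_twist_cocycle = twist_cocycle +
  assumes minimal: "N \<subseteq> M \<Longrightarrow> closed N \<Longrightarrow> N \<noteq> {} \<Longrightarrow> f ` N = N \<Longrightarrow> N = M"
    and two_slopes: "x \<in> M \<Longrightarrow> \<exists>s \<in> slopes x. \<exists>s' \<in> slopes x. s < s'"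
begin

definition "hi x = Sup (slopes x)"
definition "lo x = Inf (slopes x)"
definition "width x = hi x - lo x"
definition "alpha_hi x = a x + b x * hi x"
definition "alpha_lo x = a x + b x * lo x"

lemma bdd_slopes:
  assumes "x \<in> M"
  shows "bdd_above (slopes x)" "bdd_below (slopes x)"
proof -
  obtain L where "\<And>x s. x \<in> M \<Longrightarrow> s \<in> slopes x \<Longrightarrow> \<bar>s\<bar> \<le> L"
    using bounded_slopes by blast
  then have "\<And>s. s \<in> slopes x \<Longrightarrow> s \<le> L \<and> - L \<le> s"
    using assms by (force simp: abs_le_iff)
  then show "bdd_above (slopes x)" "bdd_below (slopes x)"
    by (meson bdd_aboveI bdd_belowI)+
qed

lemma hi_slopes: "x \<in> M \<Longrightarrow> hi x \<in> slopes x"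
  unfolding hi_def using two_slopes[of x] bdd_slopes closed_slopes
      by (intro closed_contains_Sup) auto

lemma lo_slopes: "x \<in> M \<Longrightarrow> lo x \<in> slopes x"
  unfolding lo_def using two_slopes[of x] bdd_slopes closed_slopes
      by (intro closed_contains_Inf) auto

lemma slope_le_hi: "x \<in> M \<Longrightarrow> s \<in> slopes x \<Longrightarrow> s \<le> hi x"
  unfolding hi_def using bdd_slopes by (intro cSup_upper) auto

lemma lo_le_slope: "x \<in> M \<Longrightarrow> s \<in> slopes x \<Longrightarrow> lo x \<le> s"
  unfolding lo_def using bdd_slopes by (intro cInf_lower) auto

lemma width_pos: "x \<in> M \<Longrightarrow> 0 < width x"
  using two_slopes[of x] slope_le_hi[of x] lo_le_slope[of x] unfolding width_def by fastforce

lemma alpha_pos: "x \<in> M \<Longrightarrow> 0 < alpha_hi x" "x \<in> M \<Longrightarrow> 0 < alpha_lo x"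
  unfolding alpha_hi_def alpha_lo_def by (intro slope_map_slopes hi_slopes lo_slopes; assumption)+

text \<open>The slope map is an increasing bijection from \<open>slopes x\<close> onto
  \<open>slopes (f x)\<close>, so it carries maximum to maximum.\<close>

lemma slope_map_hi:
  assumes "x \<in> M"
  shows "slope_map x (hi x) = hi (f x)"
proof (rule antisym)
  show "slope_map x (hi x) \<le> hi (f x)"
    by (intro slope_le_hi slope_map_slopes hi_slopes f_M assms)
  obtain s where s: "s \<in> slopes x" "slope_map x s = hi (f x)"
    using slope_map_surj[OF assms hi_slopes[OF f_M[OF assms]]] by blast
  then show "hi (f x) \<le> slope_map x (hi x)"
    using slope_map_mono[OF assms s(1) hi_slopes[OF assms]] slope_le_hi[OF assms s(1)] by simp
qed

lemma slope_map_lo: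
  assumes "x \<in> M"
  shows "slope_map x (lo x) = lo (f x)"
proof (rule antisym)
  show "lo (f x) \<le> slope_map x (lo x)"
    by (intro lo_le_slope slope_map_slopes lo_slopes f_M assms)
  obtain s where s: "s \<in> slopes x" "slope_map x s = lo (f x)"
    using slope_map_surj[OF assms lo_slopes[OF f_M[OF assms]]] by blast
  then show "slope_map x (lo x) \<le> lo (f x)"
    using slope_map_mono[OF assms lo_slopes[OF assms] s(1)] lo_le_slope[OF assms s(1)] by simp
qed

lemma A_hi: "x \<in> M \<Longrightarrow> A x (1, hi x) = alpha_hi x *\<^sub>R (1, hi (f x))"
  using A_slope[OF _ hi_slopes] slope_map_hi by (simp add: alpha_hi_def)

lemma A_lo: "x \<in> M \<Longrightarrow> A x (1, lo x) = alpha_lo x *\<^sub>R (1, lo (f x))"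
  using A_slope[OF _ lo_slopes] slope_map_lo by (simp add: alpha_lo_def)

lemma B_section:
  assumes "x \<in> M" "A (g x) (1, s) = t *\<^sub>R (1, s')" "t \<noteq> 0"
  shows "B x (1, s') = (1 / t) *\<^sub>R (1, s)"
proof -
  have "t *\<^sub>R B x (1, s') = B x (t *\<^sub>R (1, s'))"
    using B_scaleR[OF assms(1)] by (simp del: scaleR_Pair)
  also have "\<dots> = (1, s)"
    using BA[OF g_M[OF assms(1)], of "(1, s)"] assms by (simp add: fg)
  finally have "(1 / t) *\<^sub>R (t *\<^sub>R B x (1, s')) = (1 / t) *\<^sub>R (1, s)"
    by simp
  then show ?thesis
    using assms(3) by simp
qed

lemma B_hi: "x \<in> M \<Longrightarrow> B x (1, hi x) = (1 / alpha_hi (g x)) *\<^sub>R (1, hi (g x))"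
  using A_hi[OF g_M, of x] alpha_pos(1)[OF g_M, of x] by (intro B_section) (auto simp: fg)

lemma B_lo: "x \<in> M \<Longrightarrow> B x (1, lo x) = (1 / alpha_lo (g x)) *\<^sub>R (1, lo (g x))"
  using A_lo[OF g_M, of x] alpha_pos(2)[OF g_M, of x] by (intro B_section) (auto simp: fg)

lemma width_f: "x \<in> M \<Longrightarrow> alpha_lo x * alpha_hi x * width (f x) = width x"
  using slope_map_diff[OF _ lo_slopes hi_slopes, of x] slope_map_hi slope_map_lo
  by (simp add: alpha_lo_def alpha_hi_def width_def)

lemma wide_eq: "wide e = {x \<in> M. e \<le> width x}"
proof (intro set_eqI iffI)
  fix x assume "x \<in> wide e"
  then obtain s s' where s: "x \<in> M" "s \<in> slopes x" "s' \<in> slopes x" "s + e \<le> s'"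
    unfolding wide_def by blast
  then show "x \<in> {x \<in> M. e \<le> width x}"
    using slope_le_hi[OF s(1,3)] lo_le_slope[OF s(1,2)] by (simp add: width_def)
next
  fix x assume "x \<in> {x \<in> M. e \<le> width x}"
  then have "x \<in> M" "lo x + e \<le> hi x"
    by (simp_all add: width_def)
  then show "x \<in> wide e"
    unfolding wide_def using lo_slopes hi_slopes by blast
qed

text \<open>The last two bounds say that one step in either direction enlarges the width by at most
  a fixed factor; they make the set of points with arbitrarily thin neighbours invariant.\<close>

lemma alpha_bounds:
  obtains K where "0 < K" "\<And>x. x \<in> M \<Longrightarrow> alpha_hi x \<le> K" "\<And>x. x \<in> M \<Longrightarrow> alpha_lo x \<le> K"
    "\<And>x. x \<in> M \<Longrightarrow> width (f x) \<le> K\<^sup>2 * width x" "\<And>x. x \<in> M \<Longrightarrow> width (g x) \<le> K\<^sup>2 * width x"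
proof -
  obtain K where K: "0 < K" "\<And>x s. x \<in> M \<Longrightarrow> s \<in> slopes x \<Longrightarrow> a x + b x * s \<le> K"
    "\<And>x s. x \<in> M \<Longrightarrow> s \<in> slopes x \<Longrightarrow> 1 \<le> K * (a x + b x * s)"
    by (rule bounded_multiplier) (rule that; assumption)
  have up: "alpha_hi x \<le> K" "alpha_lo x \<le> K" if "x \<in> M" for x
    unfolding alpha_hi_def alpha_lo_def by (intro K that hi_slopes lo_slopes)+
  have wf: "width (f x) \<le> K\<^sup>2 * width x" if x: "x \<in> M" for x
  proof -
    have "1 \<le> K * alpha_lo x" "1 \<le> K * alpha_hi x"
      unfolding alpha_hi_def alpha_lo_def by (intro K x hi_slopes lo_slopes)+
    then have "1 * 1 \<le> (K * alpha_lo x) * (K * alpha_hi x)"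
      by (intro mult_mono) auto
    then have "1 * width (f x) \<le> (K * alpha_lo x) * (K * alpha_hi x) * width (f x)"
      using width_pos[OF f_M[OF x]] by (intro mult_right_mono) auto
    also have "\<dots> = K\<^sup>2 * width x"
      using width_f[OF x] by (simp add: power2_eq_square mult_ac)
    finally show ?thesis
      by simp
  qed
  have wg: "width (g x) \<le> K\<^sup>2 * width x" if x: "x \<in> M" for x
  proof -
    have "width (g x) = alpha_lo (g x) * alpha_hi (g x) * width x"
      using width_f[OF g_M[OF x]] fg[OF x] by simp
    also have "\<dots> \<le> K * K * width x"
      using up[OF g_M[OF x]] alpha_pos[OF g_M[OF x]] width_pos[OF x] K(1)
      by (intro mult_right_mono mult_mono) auto
    finally show ?thesis
      by (simp add: power2_eq_square)
  qed
  show thesis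
    by (rule that[OF K(1) up wf wg])
qed

text \<open>
  The points at which the width is not locally bounded below form a closed invariant set. It is
  not all of \<open>M\<close> by Baire, since \<open>width\<close> is positive and upper semicontinuous.
\<close>

lemma width_bounded_below:
  obtains \<delta> where "0 < \<delta>" "\<And>x. x \<in> M \<Longrightarrow> \<delta> \<le> width x"
proof -
  obtain K where K: "0 < K" "\<And>x. x \<in> M \<Longrightarrow> width (f x) \<le> K\<^sup>2 * width x"
    "\<And>x. x \<in> M \<Longrightarrow> width (g x) \<le> K\<^sup>2 * width x"
    by (rule alpha_bounds) (rule that; assumption)
  define thin where "thin e = {x \<in> M. width x < e}" for e
  define Z where "Z = M \<inter> (\<Inter>e\<in>{0<..}. closure (thin e))"
  have image_Z: "h ` Z \<subseteq> Z"
    if h: "continuous_on M h" "\<And>x. x \<in> M \<Longrightarrow> h x \<in> M" "\<And>x. x \<in> M \<Longrightarrow> width (h x) \<le> K\<^sup>2 * width x" for h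
  proof (rule image_subsetI)
    fix x assume x: "x \<in> Z"
    then have xM: "x \<in> M"
      by (simp add: Z_def)
    have "h x \<in> closure (thin e)" if e: "0 < e" for e
    proof -
      \<comment> \<open>The threshold is divided by the largest growth factor of the width in one
        step, so that \<open>h\<close> maps these thin points to points of
        \<open>thin e\<close>.\<close>
      have "x \<in> closure (thin (e / K\<^sup>2))"
        using x e K(1) by (simp add: Z_def)
      then obtain y where y: "\<And>n. y n \<in> thin (e / K\<^sup>2)" "y \<longlonglongrightarrow> x"
        unfolding closure_sequential by blast
      have "(\<lambda>n. h (y n)) \<longlonglongrightarrow> h x"
        using y by (intro tendsto_on_M[OF h(1)] xM) (auto simp: thin_def)
      moreover have "h (y n) \<in> thin e" for n
      proof -
        have "width (h (y n)) \<le> K\<^sup>2 * width (y n)"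
          using y(1)[of n] by (intro h(3)) (simp add: thin_def)
        also have "\<dots> < e"
          using y(1)[of n] K(1) by (simp add: thin_def field_simps)
        finally show ?thesis
          using y(1)[of n] by (simp add: thin_def h(2))
      qed
      ultimately show ?thesis
        by (rule limit_in_closure)
    qed
    then show "h x \<in> Z"
      using h(2)[OF xM] by (simp add: Z_def)
  qed
  have "f ` Z \<subseteq> Z"
    by (rule image_Z[OF continuous_f f_M K(2)])
  moreover have "Z \<subseteq> f ` Z"
  proof
    fix x assume x: "x \<in> Z"
    then have "g x \<in> Z"
      using image_Z[OF continuous_g g_M K(3)] by blast
    moreover have "x = f (g x)"
      using x by (simp add: Z_def fg)
    ultimately show "x \<in> f ` Z"
      by (rule rev_image_eqI)
  qed
  ultimately have "f ` Z = Z"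
    by (rule antisym)
  moreover have "closed Z" "Z \<subseteq> M"
    using compact_imp_closed[OF compact_M] by (auto simp: Z_def intro: closed_INT)
  moreover have "Z \<noteq> M"
  proof
    assume ZM: "Z = M"
    define \<G> where "\<G> = range (\<lambda>n. thin (1 / Suc n))"
    \<comment> \<open>The sets \<open>thin (1 / Suc n)\<close> are open since \<open>wide\<close> is
      closed, and dense if \<open>Z = M\<close>. A point common to all of them would have width at
      most 0.\<close>
    have "top_of_set M closure_of \<Inter>\<G> = topspace (top_of_set M)"
    proof (rule Baire_category)
      have "compact_space (top_of_set M)"
        using compact_M by (simp add: compact_space_subtopology)
      then show "completely_metrizable_space (top_of_set M) \<or>
          locally_compact_space (top_of_set M) \<and> regular_space (top_of_set M)"
        by (simp add: compact_imp_locally_compact_space metrizable_imp_regular_space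
            metrizable_space_euclidean metrizable_space_subtopology)
      show "countable \<G>"
        by (simp add: \<G>_def)
      fix T assume "T \<in> \<G>"
      then obtain n where T: "T = thin (1 / Suc n)"
        by (auto simp: \<G>_def)
      have "T = M \<inter> - wide (1 / Suc n)"
        by (auto simp: T thin_def wide_eq)
      then have "openin (top_of_set M) T"
        using closed_wide openin_open by blast
      moreover have "(1::real) / Suc n \<in> {0<..}"
        by simp
      then have "M \<subseteq> closure T"
        using ZM unfolding Z_def T by blast
      then have "top_of_set M closure_of T = M"
        by (auto simp: closure_of_subtopology T thin_def Int_absorb1)
      ultimately show "openin (top_of_set M) T \<and> top_of_set M closure_of T
          = topspace (top_of_set M)"
        by simp
    qed
    then have "\<Inter>\<G> \<noteq> {}"
      using M_nonempty by auto
    then obtain x where "\<And>n. x \<in> thin (1 / Suc n)"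
      by (auto simp: \<G>_def)
    then have "x \<in> M" "\<And>n. width x < 1 / Suc n"
      by (auto simp: thin_def)
    moreover obtain n where "1 / Suc n < width x"
      using width_pos[OF \<open>x \<in> M\<close>] nat_approx_posE by blast
    ultimately show False
      by (meson less_asym)
  qed
  ultimately have "Z = {}"
    using minimal by blast
  \<comment> \<open>Otherwise points of width below \<open>1 / Suc n\<close> accumulate somewhere in
    the compact set, and the accumulation point belongs to the empty set \<open>Z\<close>.\<close>
  have "\<exists>e>0. thin e = {}"
  proof (rule ccontr)
    assume "\<not> (\<exists>e>0. thin e = {})"
    then have "\<forall>n. \<exists>y. y \<in> thin (1 / Suc n)"
      by (meson all_not_in_conv of_nat_0_less_iff zero_less_Suc zero_less_divide_1_iff)
    then obtain y where y: "\<And>n. y n \<in> thin (1 / Suc n)"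
      by metis
    then have "\<forall>n. y n \<in> M"
      by (simp add: thin_def)
    then obtain x r where x: "x \<in> M" and r: "strict_mono r" "(y \<circ> r) \<longlonglongrightarrow> x"
      using compact_M unfolding compact_def by blast
    have "x \<in> closure (thin e)" if e: "0 < e" for e
    proof -
      obtain N where N: "1 / Suc N < e"
        using e nat_approx_posE by blast
      have "(y \<circ> r) (n + N) \<in> thin e" for n
      proof -
        have "N \<le> r (n + N)"
          using seq_suble[OF r(1), of "n + N"] by simp
        then have "1 / Suc (r (n + N)) \<le> 1 / Suc N"
          by (simp add: frac_le)
        then show ?thesis
          using y[of "r (n + N)"] N by (simp add: thin_def)
      qed
      then show ?thesis
        by (rule limit_in_closure[OF LIMSEQ_ignore_initial_segment[OF r(2)]])
    qed
    with x \<open>Z = {}\<close> show False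
      by (auto simp: Z_def)
  qed
  then obtain e where "0 < e" "thin e = {}"
    by blast
  then show thesis
    by (intro that[of e]) (auto simp: thin_def not_less)
qed

end

text \<open>A quadratic form shrinking by \<open>q\<close> means lengths shrinking by
  \<open>sqrt q\<close>. The factor \<open>sqrt (D / \<delta>)\<close> is the cost of comparing the
  form with lengths at the two ends of the orbit.\<close>

lemma abs_le_of_geometric_bound:
  fixes p q \<delta> D :: real
  assumes "q ^ n * p\<^sup>2 * \<delta> \<le> D" "0 < q" "0 < \<delta>" "0 < D"
  shows "\<bar>p\<bar> \<le> sqrt (D / \<delta>) * (1 / sqrt q) ^ n"
proof (rule power2_le_imp_le)
  have "(sqrt (D / \<delta>) * (1 / sqrt q) ^ n)\<^sup>2 = D / \<delta> * (1 / q) ^ n"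
  proof -
    have "((1 / sqrt q) ^ n)\<^sup>2 = ((1 / sqrt q)\<^sup>2) ^ n"
      by (simp only: power_mult[symmetric] mult.commute)
    then show ?thesis
      using assms(2-4) by (simp add: power_mult_distrib power_divide)
  qed
  moreover have "p\<^sup>2 \<le> D / \<delta> * (1 / q) ^ n"
    using assms by (simp add: field_simps power_divide)
  ultimately show "\<bar>p\<bar>\<^sup>2 \<le> (sqrt (D / \<delta>) * (1 / sqrt q) ^ n)\<^sup>2"
    by simp
  show "0 \<le> sqrt (D / \<delta>) * (1 / sqrt q) ^ n"
    using assms(2-4) by simp
qed

lemma zero_if_geometric_bound:
  fixes t q C :: real
  assumes "\<And>n. q ^ n * t \<le> C" "1 < q" "0 \<le> t"
  shows "t = 0"
proof (rule ccontr)
  assume "t \<noteq> 0"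
  then have "0 < t"
    using assms(3) by simp
  obtain n where "C / t < q ^ n"
    using real_arch_pow[OF assms(2)] by blast
  then show False
    using assms(1)[of n] \<open>0 < t\<close> by (simp add: field_simps)
qed

section \<open>Uniform hyperbolicity\<close>

text \<open>\<open>q\<close> is the one-step gain, \<delta> and \<open>D\<close> make the form given
  by the width uniformly comparable to a fixed one, and \<open>L\<close> does the same for the
  Euclidean norm and the first coordinate. \<open>lo_step\<close> says that the lower slope is
  contracted, \<open>hi_step\<close> that the upper one is expanded.\<close>

locale gap_twist_cocycle = wide_twist_cocycle +
  fixes q \<delta> D L :: real
  assumes q_gt_1: "1 < q" and \<delta>_pos: "0 < \<delta>" and D_pos: "0 < D" and L_pos: "0 < L"
    and width_ge: "x \<in> M \<Longrightarrow> \<delta> \<le> width x" and width_le: "x \<in> M \<Longrightarrow> width x \<le> D"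
    and abs_slope_le: "x \<in> M \<Longrightarrow> s \<in> slopes x \<Longrightarrow> \<bar>s\<bar> \<le> L"
    and lo_step: "x \<in> M \<Longrightarrow> q * (alpha_lo x)\<^sup>2 * width (f x) \<le> width x"
    and hi_step: "x \<in> M \<Longrightarrow> q * width x \<le> (alpha_hi x)\<^sup>2 * width (f x)"
begin

lemma inverse_hi_step:
  assumes "x \<in> M"
  shows "q * (1 / alpha_hi (g x))\<^sup>2 * width (g x) \<le> width x"
  using hi_step[OF g_M[OF assms]] alpha_pos(1)[OF g_M[OF assms]] fg[OF assms]
  by (simp add: power_divide divide_le_eq mult.commute)

lemma inverse_lo_step:
  assumes "x \<in> M"
  shows "q * width x \<le> (1 / alpha_lo (g x))\<^sup>2 * width (g x)"
  using lo_step[OF g_M[OF assms]] alpha_pos(2)[OF g_M[OF assms]] fg[OF assms]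
  by (simp add: power_divide le_divide_eq mult_ac)

text \<open>The orbit estimate for the form, with the width at the end replaced by its lower bound
  \<delta> and at the start by its upper bound \<open>D\<close>. The bound on \<open>p\<close>
  therefore does not depend on the base point, which lets it pass to limits.\<close>

lemma Apow_lo:
  assumes "x \<in> M"
  obtains p y where "\<And>t. Apow n x (t *\<^sub>R (1, lo x)) = (t * p) *\<^sub>R (1, lo y)" "y \<in> M"
    "q ^ n * p\<^sup>2 * \<delta> \<le> D"
proof -
  let ?p = "\<Prod>i<n. alpha_lo ((f ^^ i) x)" and ?y = "(f ^^ n) x"
  have y: "?y \<in> M"
    using assms by (induction n) (simp_all add: f_M)
  have "Apow n x (t *\<^sub>R (1, lo x)) = (t * ?p) *\<^sub>R (1, lo ?y)" for t
    by (rule cocycle_pow_section[where h = f and L = A and \<sigma> = lo and m = alpha_lo,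
          OF f_M A_scaleR A_lo assms])
  moreover have "q ^ n * ?p\<^sup>2 * \<delta> \<le> D"
  proof -
    have "q ^ n * ?p\<^sup>2 * \<delta> \<le> q ^ n * ?p\<^sup>2 * width ?y"
      using q_gt_1 by (intro mult_left_mono width_ge y) simp
    also have "\<dots> \<le> width x"
      using q_gt_1 by (intro prod_orbit_le[where h = f and m = alpha_lo and w
          = width, OF f_M _ lo_step assms]) simp_all
    finally show ?thesis
      using width_le[OF assms] by simp
  qed
  ultimately show thesis
    using that y by blast
qed

lemma Bpow_hi:
  assumes "x \<in> M"
  obtains p y where "\<And>t. Bpow n x (t *\<^sub>R (1, hi x)) = (t * p) *\<^sub>R (1, hi y)" "y \<in> M"
    "q ^ n * p\<^sup>2 * \<delta> \<le> D"
proof -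
  let ?p = "\<Prod>i<n. 1 / alpha_hi (g ((g ^^ i) x))" and ?y = "(g ^^ n) x"
  have y: "?y \<in> M"
    using assms by (induction n) (simp_all add: g_M)
  have "Bpow n x (t *\<^sub>R (1, hi x)) = (t * ?p) *\<^sub>R (1, hi ?y)" for t
    by (rule cocycle_pow_section[where h = g and L = B and \<sigma> = hi and m = "\<lambda>x. 1 / alpha_hi (g x)",
          OF g_M B_scaleR B_hi assms])
  moreover have "q ^ n * ?p\<^sup>2 * \<delta> \<le> D"
  proof -
    have "q ^ n * ?p\<^sup>2 * \<delta> \<le> q ^ n * ?p\<^sup>2 * width ?y"
      using q_gt_1 by (intro mult_left_mono width_ge y) simp
    also have "\<dots> \<le> width x"
      using q_gt_1 by (intro prod_orbit_le[where h = g and m = "\<lambda>x. 1 / alpha_hi (g x)" and w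
          = width,
            OF g_M _ inverse_hi_step assms]) simp_all
    finally show ?thesis
      using width_le[OF assms] by simp
  qed
  ultimately show thesis
    using that y by blast
qed

lemma Apow_hi:
  assumes "x \<in> M"
  shows "q ^ n * \<delta> \<le> (fst (Apow n x (1, hi x)))\<^sup>2 * D"
proof -
  let ?p = "\<Prod>i<n. alpha_hi ((f ^^ i) x)" and ?y = "(f ^^ n) x"
  have y: "?y \<in> M"
    using assms by (induction n) (simp_all add: f_M)
  have "Apow n x (1 *\<^sub>R (1, hi x)) = (1 * ?p) *\<^sub>R (1, hi ?y)"
    by (rule cocycle_pow_section[where h = f and L = A and \<sigma> = hi and m = alpha_hi,
          OF f_M A_scaleR A_hi assms])
  then have p: "fst (Apow n x (1, hi x)) = ?p"
    by simp
  have "q ^ n * \<delta> \<le> q ^ n * width x"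
    using q_gt_1 by (intro mult_left_mono width_ge assms) simp
  also have "\<dots> \<le> ?p\<^sup>2 * width ?y"
    using q_gt_1 by (intro prod_orbit_ge[where h = f and m = alpha_hi and w
        = width, OF f_M _ hi_step assms]) simp_all
  also have "\<dots> \<le> ?p\<^sup>2 * D"
    by (intro mult_left_mono width_le y) simp
  finally show ?thesis
    by (simp only: p)
qed

lemma Bpow_lo:
  assumes "x \<in> M"
  shows "q ^ n * \<delta> \<le> (fst (Bpow n x (1, lo x)))\<^sup>2 * D"
proof -
  let ?p = "\<Prod>i<n. 1 / alpha_lo (g ((g ^^ i) x))" and ?y = "(g ^^ n) x"
  have y: "?y \<in> M"
    using assms by (induction n) (simp_all add: g_M)
  have "Bpow n x (1 *\<^sub>R (1, lo x)) = (1 * ?p) *\<^sub>R (1, lo ?y)"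
    by (rule cocycle_pow_section[where h = g and L = B and \<sigma> = lo and m = "\<lambda>x. 1 / alpha_lo (g x)",
          OF g_M B_scaleR B_lo assms])
  then have p: "fst (Bpow n x (1, lo x)) = ?p"
    by simp
  have "q ^ n * \<delta> \<le> q ^ n * width x"
    using q_gt_1 by (intro mult_left_mono width_ge assms) simp
  also have "\<dots> \<le> ?p\<^sup>2 * width ?y"
    using q_gt_1 by (intro prod_orbit_ge[where h = g and m = "\<lambda>x. 1 / alpha_lo (g x)" and w = width,
          OF g_M _ inverse_lo_step assms]) simp_all
  also have "\<dots> \<le> ?p\<^sup>2 * D"
    by (intro mult_left_mono width_le y) simp
  finally show ?thesis
    by (simp only: p)
qed

text \<open>
  A slope whose iterates stay bounded has no component along the expanding direction; this
  property is inherited by limits of \<open>lo\<close> (forward) and of \<open>hi\<close> (backward).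
\<close>

lemma combination_eq_zero:
  fixes u v :: "nat \<Rightarrow> real" and t :: real
  assumes "\<And>n. q ^ n * (t * u n + v n)\<^sup>2 * \<delta> \<le> D" "\<And>n. q ^ n * \<delta> \<le> (u n)\<^sup>2 * D"
    and "\<And>n. 0 \<le> u n" "\<And>n. 0 \<le> v n" "0 \<le> t"
  shows "t = 0"
proof -
  have "q ^ n * t\<^sup>2 \<le> D\<^sup>2 / \<delta>\<^sup>2" for n
  proof -
    \<comment> \<open>A second factor \<open>q ^ n\<close> is inserted so that one can be spent on
      the growth of \<open>u n\<close> and the other on the decay of the sum.\<close>
    have "1 * (q ^ n * t\<^sup>2 * \<delta>\<^sup>2) \<le> q ^ n * (q ^ n * t\<^sup>2 * \<delta>\<^sup>2)"
      using q_gt_1 by (intro mult_right_mono one_le_power) auto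
    also have "\<dots> = (q ^ n * \<delta>) * (q ^ n * t\<^sup>2 * \<delta>)"
      by (simp add: power2_eq_square mult_ac)
    also have "\<dots> \<le> ((u n)\<^sup>2 * D) * (q ^ n * t\<^sup>2 * \<delta>)"
      using q_gt_1 \<delta>_pos by (intro mult_right_mono assms(2)) auto
    also have "\<dots> = D * (q ^ n * (t * u n)\<^sup>2 * \<delta>)"
      by (simp add: power_mult_distrib mult_ac)
    also have "\<dots> \<le> D * (q ^ n * (t * u n + v n)\<^sup>2 * \<delta>)"
      using assms(3)[of n] assms(4)[of n] assms(5) q_gt_1 \<delta>_pos D_pos
      by (intro mult_left_mono mult_right_mono power_mono) auto
    also have "\<dots> \<le> D * D"
      using D_pos by (intro mult_left_mono assms(1)) auto
    finally show ?thesis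
      using \<delta>_pos by (simp add: power2_eq_square field_simps)
  qed
  then have "t\<^sup>2 = 0"
    by (intro zero_if_geometric_bound[OF _ q_gt_1]) auto
  then show ?thesis
    by simp
qed

lemma cone_pow_nonneg: "s \<in> slopes x \<Longrightarrow> 0 \<le> fst (Apow n x (1, s)) \<and> 0 \<le> fst (Bpow n x (1, s))"
  by (simp add: slopes_def positive_cone_def)

lemma Bpow_add: "x \<in> M \<Longrightarrow> Bpow n x (v + w) = Bpow n x v + Bpow n x w"
  by (induction n arbitrary: x v w) (simp_all add: B_add g_M)

lemma slope_combination:
  assumes "x \<in> M"
  shows "(1 :: real, s) = ((s - lo x) / width x) *\<^sub>R (1, hi x) + ((hi x - s) / width x) *\<^sub>R (1, lo
      x)"
proof -
  have "s * width x = (s - lo x) * hi x + (hi x - s) * lo x"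
    by (simp add: width_def algebra_simps)
  then have "s = (s - lo x) / width x * hi x + (hi x - s) / width x * lo x"
    using width_pos[OF assms] by (simp add: field_simps)
  moreover have "(s - lo x) / width x + (hi x - s) / width x = 1"
    using width_pos[OF assms] by (simp add: width_def flip: add_divide_distrib)
  ultimately show ?thesis
    by (simp add: prod_eq_iff)
qed

text \<open>A limit \<open>t\<close> of lower slopes is a slope at \<open>x\<close>, and
  \<open>(1, t)\<close> is a combination of \<open>(1, lo x)\<close> and \<open>(1, hi x)\<close>
  with nonnegative coefficients. Its iterates decay while those of the \<open>hi\<close> part grow,
  and no cancellation is possible since all first coordinates in the cone are nonnegative.\<close>

lemma continuous_lo: "continuous_on M lo"
proof (rule continuous_on_closed_graph_bounded)
  show "\<bar>lo x\<bar> \<le> L" if "x \<in> M" for x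
    by (rule abs_slope_le[OF that lo_slopes[OF that]])
  fix X x t
  assume X: "\<And>n. X n \<in> M" and x: "x \<in> M" and lim: "X \<longlonglongrightarrow> x" "(\<lambda>n. lo (X n)) \<longlonglongrightarrow> t"
  have t: "t \<in> slopes x"
    by (rule slopes_closed_graph[OF X x lim]) (intro lo_slopes X)
  \<comment> \<open>For fixed \<open>k\<close> the contraction estimate holds along the sequence
    with the same constants and is closed in the base point and slope.\<close>
  have bound: "q ^ k * (fst (Apow k x (1, t)))\<^sup>2 * \<delta> \<le> D" for k
  proof (rule LIMSEQ_le_const2)
    show "(\<lambda>n. q ^ k * (fst (Apow k (X n) (1, lo (X n))))\<^sup>2 * \<delta>)
        \<longlonglongrightarrow> q ^ k * (fst (Apow k x (1, t)))\<^sup>2 * \<delta>"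
      by (intro tendsto_intros tendsto_Apow X x lim)
    have "q ^ k * (fst (Apow k (X n) (1, lo (X n))))\<^sup>2 * \<delta> \<le> D" for n
      using Apow_lo[OF X[of n], of k] by (metis fst_scaleR fst_conv mult_1 mult_1_right
          real_scaleR_def scaleR_one)
    then show "\<exists>N. \<forall>n\<ge>N. q ^ k * (fst (Apow k (X n) (1, lo (X n))))\<^sup>2 * \<delta> \<le> D"
      by blast
  qed
  have "fst (Apow k x (1, t)) = (t - lo x) / width x * fst (Apow k x (1, hi x)) +
      (hi x - t) / width x * fst (Apow k x (1, lo x))" for k
    by (subst slope_combination[OF x]) (simp add: Apow_add x Apow_scaleR del: scaleR_Pair)
  then have "(t - lo x) / width x = 0"
    using bound Apow_hi[OF x] cone_pow_nonneg[OF hi_slopes[OF x]] cone_pow_nonneg[OF lo_slopes[OF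
        x]]
      lo_le_slope[OF x t] slope_le_hi[OF x t] width_pos[OF x]
    by (intro combination_eq_zero[of _ "\<lambda>k. fst (Apow k x (1, hi x))"
          "\<lambda>k. (hi x - t) / width x * fst (Apow k x (1, lo x))"]) auto
  then show "t = lo x"
    using width_pos[OF x] by simp
qed

lemma continuous_hi: "continuous_on M hi"
proof (rule continuous_on_closed_graph_bounded)
  show "\<bar>hi x\<bar> \<le> L" if "x \<in> M" for x
    by (rule abs_slope_le[OF that hi_slopes[OF that]])
  fix X x t
  assume X: "\<And>n. X n \<in> M" and x: "x \<in> M" and lim: "X \<longlonglongrightarrow> x" "(\<lambda>n. hi (X n)) \<longlonglongrightarrow> t"
  have t: "t \<in> slopes x"
    by (rule slopes_closed_graph[OF X x lim]) (intro hi_slopes X)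
  have bound: "q ^ k * (fst (Bpow k x (1, t)))\<^sup>2 * \<delta> \<le> D" for k
  proof (rule LIMSEQ_le_const2)
    show "(\<lambda>n. q ^ k * (fst (Bpow k (X n) (1, hi (X n))))\<^sup>2 * \<delta>)
        \<longlonglongrightarrow> q ^ k * (fst (Bpow k x (1, t)))\<^sup>2 * \<delta>"
      by (intro tendsto_intros tendsto_Bpow X x lim)
    have "q ^ k * (fst (Bpow k (X n) (1, hi (X n))))\<^sup>2 * \<delta> \<le> D" for n
      using Bpow_hi[OF X[of n], of k] by (metis fst_scaleR fst_conv mult_1 mult_1_right
          real_scaleR_def scaleR_one)
    then show "\<exists>N. \<forall>n\<ge>N. q ^ k * (fst (Bpow k (X n) (1, hi (X n))))\<^sup>2 * \<delta> \<le> D"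
      by blast
  qed
  have "fst (Bpow k x (1, t)) = (hi x - t) / width x * fst (Bpow k x (1, lo x)) +
      (t - lo x) / width x * fst (Bpow k x (1, hi x))" for k
    by (subst slope_combination[OF x]) (simp add: Bpow_add x Bpow_scaleR del: scaleR_Pair)
  then have "(hi x - t) / width x = 0"
    using bound Bpow_lo[OF x] cone_pow_nonneg[OF hi_slopes[OF x]] cone_pow_nonneg[OF lo_slopes[OF
        x]]
      lo_le_slope[OF x t] slope_le_hi[OF x t] width_pos[OF x]
    by (intro combination_eq_zero[of _ "\<lambda>k. fst (Bpow k x (1, lo x))"
          "\<lambda>k. (t - lo x) / width x * fst (Bpow k x (1, hi x))"]) auto
  then show "t = hi x"
    using width_pos[OF x] by simp
qed

text \<open>Here \<open>s\<close> is the slope at the end of the orbit and \<open>s'\<close> the one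
  at its start. The latter may be arbitrary, as the norm of \<open>t *\<^sub>R (1, s')\<close> is at
  least the absolute value of \<open>t\<close>.\<close>

lemma norm_section_le:
  assumes "\<bar>s\<bar> \<le> L" "q ^ n * p\<^sup>2 * \<delta> \<le> D"
  shows "norm ((t * p) *\<^sub>R (1 :: real, s)) \<le> (1 + L) * sqrt (D / \<delta>) * (1 / sqrt q) ^ n * norm (t *\<^sub>R
      (1 :: real, s'))"
proof -
  have "norm (1 :: real, s) \<le> 1 + L"
    using norm_Pair_le[of "1 :: real" s] assms(1) by simp
  moreover have "\<bar>p\<bar> \<le> sqrt (D / \<delta>) * (1 / sqrt q) ^ n"
    using abs_le_of_geometric_bound[OF assms(2)] q_gt_1 \<delta>_pos D_pos by simp
  ultimately have "\<bar>t\<bar> * (\<bar>p\<bar> * norm (1 :: real, s)) \<le>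
      \<bar>t\<bar> * ((sqrt (D / \<delta>) * (1 / sqrt q) ^ n) * (1 + L))"
    by (intro mult_left_mono mult_mono) auto
  also have "\<dots> = (1 + L) * sqrt (D / \<delta>) * (1 / sqrt q) ^ n * \<bar>t\<bar>"
    by simp
  also have "\<dots> \<le> (1 + L) * sqrt (D / \<delta>) * (1 / sqrt q) ^ n * norm (t *\<^sub>R (1 :: real, s'))"
    using L_pos q_gt_1 \<delta>_pos D_pos norm_fst_le[of t "t *\<^sub>R s'"]
    by (intro mult_left_mono) auto
  finally show ?thesis
    by (simp add: abs_mult mult.assoc del: scaleR_Pair)
qed

lemma image_span_section:
  assumes "\<And>t v. h (t *\<^sub>R v) = t *\<^sub>R h v" "h (1 :: real, s :: real)
      = m *\<^sub>R (1 :: real, s' :: real)" "m \<noteq> 0"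
  shows "h ` range (\<lambda>t. t *\<^sub>R (1, s)) = range (\<lambda>t. t *\<^sub>R (1, s'))"
proof -
  have "h (t *\<^sub>R (1, s)) = (t * m) *\<^sub>R (1, s')" for t
    by (simp only: assms(1,2) scaleR_scaleR)
  moreover have "t *\<^sub>R (1, s') = h ((t / m) *\<^sub>R (1, s))" for t
    using assms(3) by (simp only: assms(1,2) scaleR_scaleR) simp
  ultimately show ?thesis
    by (metis (no_types, lifting) image_subset_iff rangeI subsetI subset_antisym imageE image_eqI)
qed

text \<open>Cramer's rule: the coefficient is the coordinate of \<open>v\<close> along
  \<open>(1, lo x)\<close> in the basis formed by \<open>(1, lo x)\<close> and
  \<open>(1, hi x)\<close>.\<close>

definition stable_proj :: "'a \<Rightarrow> (real \<times> real) \<Rightarrow>\<^sub>L (real \<times> real)"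
  where "stable_proj x = Blinfun (\<lambda>v. ((hi x * fst v - snd v) / width x) *\<^sub>R (1, lo x))"

lemma stable_proj_apply:
  "blinfun_apply (stable_proj x) v = ((hi x * fst v - snd v) / width x) *\<^sub>R (1, lo x)"
proof -
  have "bounded_linear (\<lambda>v. ((hi x * fst v - snd v) / width x) *\<^sub>R (1 :: real, lo x))"
    unfolding linear_conv_bounded_linear[symmetric]
    by (rule linearI) (simp_all add: algebra_simps add_divide_distrib diff_divide_distrib)
  then show ?thesis
    by (simp only: stable_proj_def bounded_linear_Blinfun_apply)
qed

lemma hyperbolic: "hyperbolic_cocycle M f g A B"
proof -
  define Es Eu where "Es x = range (\<lambda>t. t *\<^sub>R (1 :: real, lo x))"
    and "Eu x = range (\<lambda>t. t *\<^sub>R (1 :: real, hi x))" for x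
  let ?C = "(1 + L) * sqrt (D / \<delta>)" and ?c = "1 / sqrt q"
  have cont: "continuous_on M (\<lambda>x. blinfun_apply (stable_proj x) v)" for v
    unfolding stable_proj_apply width_def
    using width_pos unfolding width_def
    by (intro continuous_intros continuous_lo continuous_hi) force
  have split: "hyperbolic_splitting f g A B ?C ?c Es Eu (stable_proj x) x" if x: "x \<in> M" for x
    unfolding hyperbolic_splitting_def
  proof (intro conjI allI ballI)
    have w: "width x \<noteq> 0" "hi x - lo x \<noteq> 0"
      using width_pos[OF x] by (auto simp: width_def)
    show "subspace (Es x)" "subspace (Eu x)"
      unfolding Es_def Eu_def span_singleton[symmetric] by (rule subspace_span)+
    have "t = 0" if "t *\<^sub>R (1 :: real, lo x) = u *\<^sub>R (1, hi x)" for t u :: real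
      using that w(2) by auto
    then have "Es x \<inter> Eu x \<subseteq> {0}"
      unfolding Es_def Eu_def by (auto simp: zero_prod_def)
    moreover have "0 \<in> Es x \<inter> Eu x"
      using \<open>subspace (Es x)\<close> \<open>subspace (Eu x)\<close> by (simp add: subspace_0)
    ultimately show "Es x \<inter> Eu x = {0}"
      by blast
    have "v = ((hi x * fst v - snd v) / width x) *\<^sub>R (1, lo x) + ((snd v - lo x * fst v) / width x)
        *\<^sub>R (1, hi x)" for v
    proof -
      have "(hi x * fst v - snd v) + (snd v - lo x * fst v) = fst v * width x"
        "(hi x * fst v - snd v) * lo x + (snd v - lo x * fst v) * hi x = snd v * width x"
        by (simp_all add: width_def algebra_simps)
      then have "(hi x * fst v - snd v) / width x + (snd v - lo x * fst v) / width x = fst v"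
        "(hi x * fst v - snd v) / width x * lo x + (snd v - lo x * fst v) / width x * hi x = snd v"
        using w(1) by (simp_all flip: add_divide_distrib)
      then show ?thesis
        by (simp add: prod_eq_iff)
    qed
    then have "v \<in> {v + w |v w. v \<in> Es x \<and> w \<in> Eu x}" for v
      unfolding Es_def Eu_def by blast
    then show "{v + w |v w. v \<in> Es x \<and> w \<in> Eu x} = UNIV"
      by blast
    show "stable_proj x v = v" if "v \<in> Es x" for v
    proof -
      from that obtain t where v: "v = t *\<^sub>R (1, lo x)"
        by (auto simp: Es_def)
      have "(hi x * fst v - snd v) / width x = t"
        using w by (simp add: v width_def field_simps)
      then show ?thesis
        by (simp only: stable_proj_apply v)
    qed
    show "stable_proj x v = 0" if "v \<in> Eu x" for v
      using that by (auto simp: Eu_def stable_proj_apply zero_prod_def)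
    show "A x ` Es x = Es (f x)" "A x ` Eu x = Eu (f x)"
      unfolding Es_def Eu_def using alpha_pos[OF x]
      by (simp_all add: image_span_section[OF A_scaleR[OF x] A_lo[OF x]]
          image_span_section[OF A_scaleR[OF x] A_hi[OF x]] del: scaleR_Pair)
    show "B x ` Es x = Es (g x)" "B x ` Eu x = Eu (g x)"
      unfolding Es_def Eu_def using alpha_pos[OF g_M[OF x]]
      by (simp_all add: image_span_section[OF B_scaleR[OF x] B_lo[OF x]]
          image_span_section[OF B_scaleR[OF x] B_hi[OF x]] del: scaleR_Pair)
    show "norm (Apow n x v) \<le> ?C * ?c ^ n * norm v" if v: "v \<in> Es x" for n v
    proof -
      obtain t where t: "v = t *\<^sub>R (1, lo x)"
        using v by (auto simp: Es_def)
      obtain p y where p: "\<And>t. Apow n x (t *\<^sub>R (1, lo x)) = (t * p) *\<^sub>R (1, lo y)" "y \<in> M"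
        "q ^ n * p\<^sup>2 * \<delta> \<le> D"
        using Apow_lo[OF x] by blast
      show ?thesis
        unfolding t p(1) by (rule norm_section_le[OF abs_slope_le[OF p(2) lo_slopes[OF p(2)]] p(3)])
    qed
    show "norm (Bpow n x v) \<le> ?C * ?c ^ n * norm v" if v: "v \<in> Eu x" for n v
    proof -
      obtain t where t: "v = t *\<^sub>R (1, hi x)"
        using v by (auto simp: Eu_def)
      obtain p y where p: "\<And>t. Bpow n x (t *\<^sub>R (1, hi x)) = (t * p) *\<^sub>R (1, hi y)" "y \<in> M"
        "q ^ n * p\<^sup>2 * \<delta> \<le> D"
        using Bpow_hi[OF x] by blast
      show ?thesis
        unfolding t p(1) by (rule norm_section_le[OF abs_slope_le[OF p(2) hi_slopes[OF p(2)]] p(3)])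
    qed
  qed
  have "0 < ?C" "0 < ?c" "?c < 1"
    using L_pos D_pos \<delta>_pos q_gt_1 by simp_all
  then show ?thesis
    unfolding hyperbolic_cocycle_def using cont split
    by (intro exI[of _ Es] exI[of _ Eu] exI[of _ stable_proj] exI[of _ ?C] exI[of _ ?c] conjI allI
        ballI)
qed

end

lemma (in wide_twist_cocycle) hyperbolic: "hyperbolic_cocycle M f g A B"
proof -
  obtain \<delta> where \<delta>: "0 < \<delta>" "\<And>x. x \<in> M \<Longrightarrow> \<delta> \<le> width x"
    by (rule width_bounded_below) (rule that; assumption)
  obtain L where L: "0 < L" "\<And>x s. x \<in> M \<Longrightarrow> s \<in> slopes x \<Longrightarrow> \<bar>s\<bar> \<le> L"
    by (rule bounded_slopes) (rule that; assumption)
  obtain K where K: "0 < K" "\<And>x. x \<in> M \<Longrightarrow> alpha_lo x \<le> K"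
    by (rule alpha_bounds) (rule that; assumption)
  obtain \<beta> where \<beta>: "0 < \<beta>" "\<And>x. x \<in> M \<Longrightarrow> \<beta> \<le> b x"
  proof -
    obtain z where "z \<in> M" "\<And>x. x \<in> M \<Longrightarrow> b z \<le> b x"
      using continuous_attains_inf[OF compact_M M_nonempty continuous_entries(2)] by blast
    then show thesis
      using that[of "b z"] b_pos by blast
  qed
  \<comment> \<open>The multipliers differ by \<open>b x * width x\<close>, which is at least
    \<beta> times \<delta>, while \<open>alpha_lo x\<close> is at most \<open>K\<close>. Hence their
    ratio is at least this \<open>q\<close>.\<close>
  define q where "q = 1 + \<beta> * \<delta> / K"
  have q: "1 < q"
    using \<beta>(1) \<delta>(1) K(1) by (simp add: q_def)
  have alpha: "q * alpha_lo x \<le> alpha_hi x" if x: "x \<in> M" for x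
  proof -
    have "\<beta> * \<delta> / K * alpha_lo x \<le> \<beta> * \<delta> / K * K"
      using \<beta>(1) \<delta>(1) K by (intro mult_left_mono K(2) x) simp
    also have "\<dots> \<le> b x * width x"
      using K(1) \<beta>(1) \<delta>(1) mult_mono[OF \<beta>(2)[OF x] \<delta>(2)[OF x]] b_pos[OF x] by simp
    also have "\<dots> = alpha_hi x - alpha_lo x"
      by (simp add: alpha_hi_def alpha_lo_def width_def algebra_simps)
    finally show ?thesis
      by (simp add: q_def algebra_simps)
  qed
  interpret gap_twist_cocycle M f g A B a b c d q \<delta> "2 * L" L
  proof
    fix x assume x: "x \<in> M"
    show "width x \<le> 2 * L"
      using L(2)[OF x hi_slopes[OF x]] L(2)[OF x lo_slopes[OF x]] by (simp add: width_def)
    \<comment> \<open>Trading one factor \<open>q * alpha_lo x\<close> for \<open>alpha_hi x\<close>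
      turns the square into the product of the two multipliers, whose effect on the width is exact
      by \<open>width_f\<close>. The expanding estimate below makes the same trade.\<close>
    have "q * alpha_lo x * (alpha_lo x * width (f x)) \<le> alpha_hi x * (alpha_lo x * width (f x))"
      using alpha_pos(2)[OF x] width_pos[OF f_M[OF x]] by (intro mult_right_mono alpha x) simp
    then show "q * (alpha_lo x)\<^sup>2 * width (f x) \<le> width x"
      using width_f[OF x] by (simp add: power2_eq_square mult_ac)
    have "q * width x = q * alpha_lo x * (alpha_hi x * width (f x))"
      using width_f[OF x] by (simp add: mult_ac)
    also have "\<dots> \<le> alpha_hi x * (alpha_hi x * width (f x))"
      using alpha_pos(1)[OF x] width_pos[OF f_M[OF x]] by (intro mult_right_mono alpha x) simp
    finally show "q * width x \<le> (alpha_hi x)\<^sup>2 * width (f x)"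
      by (simp add: power2_eq_square mult_ac)
  qed (use q \<delta> L in auto)
  show ?thesis
    by (rule hyperbolic)
qed

section \<open>The dichotomy between hyperbolicity and a dense set of degenerate cones\<close>

lemma slope_line:
  "subspace (span {(1 :: real, s :: real)})" "dim (span {(1 :: real, s)}) = 1"
  by (simp_all add: dim_singleton zero_prod_def)


lemma (in twist_cocycle) Cone_subset_line:
  assumes "x \<in> M" "\<not> (\<exists>s \<in> slopes x. \<exists>s' \<in> slopes x. s < s')"
  shows "\<exists>D. subspace D \<and> dim D = 1 \<and> Cone x \<subseteq> D"
proof -
  \<comment> \<open>If there is no slope at all, the cone is trivial and \<open>s\<close> is an
    arbitrary number, so that any such line will do.\<close>
  obtain s where s: "slopes x \<subseteq> {s}"
    using assms(2) by (metis antisym_conv3 insertI1 subsetI)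
  have "v \<in> span {(1, s)}" if v: "v \<in> Cone x" for v
  proof (cases "v = 0")
    case False
    then have "0 < fst v" "snd v / fst v = s"
      using cone_iff_slopes[OF assms(1)] v s by auto
    then have "v = fst v *\<^sub>R (1, s)"
      by (auto simp: prod_eq_iff)
    then show ?thesis
      by (metis span_mul span_base singletonI)
  qed (simp add: span_zero)
  then show ?thesis
    using slope_line[of s] by blast
qed

lemma (in twist_cocycle) hyperbolic_or_regular:
  assumes minimal: "\<And>N. N \<subseteq> M \<Longrightarrow> closed N \<Longrightarrow> N \<noteq> {} \<Longrightarrow> f ` N = N \<Longrightarrow> N = M"
  shows "hyperbolic_cocycle M f g A B \<or>
    (\<exists>G. gdelta_in (top_of_set M) G \<and> M \<subseteq> closure G \<and>
      (\<forall>x\<in>G. \<exists>D. subspace D \<and> dim D = 1 \<and> Cone x \<subseteq> D))"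
proof -
  define R where "R = {x \<in> M. \<not> (\<exists>s \<in> slopes x. \<exists>s' \<in> slopes x. s < s')}"
  show ?thesis
  proof (cases "R = {}")
    case True
    then interpret wide_twist_cocycle M f g A B a b c d
      using minimal by unfold_locales (auto simp: R_def)
    show ?thesis
      using hyperbolic by blast
  next
    case False
    have wide_R: "(\<exists>s \<in> slopes x. \<exists>s' \<in> slopes x. s < s') \<longleftrightarrow> (\<exists>n. x \<in> wide (1 / Suc n))"
        if "x \<in> M" for x
    proof
      assume "\<exists>s \<in> slopes x. \<exists>s' \<in> slopes x. s < s'"
      then obtain s s' where s: "s \<in> slopes x" "s' \<in> slopes x" "0 < s' - s"
        by auto
      obtain n where "1 / Suc n < s' - s"
        using nat_approx_posE[OF s(3)] by blast
      then have "s + 1 / Suc n \<le> s'"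
        by simp
      then show "\<exists>n. x \<in> wide (1 / Suc n)"
        unfolding wide_def using that s by blast
    next
      assume "\<exists>n. x \<in> wide (1 / Suc n)"
      then obtain n s s' where "s \<in> slopes x" "s' \<in> slopes x" "s + 1 / Suc n \<le> s'"
        unfolding wide_def by blast
      moreover have "0 < 1 / real (Suc n)"
        by simp
      ultimately show "\<exists>s \<in> slopes x. \<exists>s' \<in> slopes x. s < s'"
        by (metis less_add_same_cancel1 order_less_le_trans)
    qed
    have "R = (\<Inter>n. M \<inter> - wide (1 / Suc n))"
      using wide_R by (auto simp: R_def)
    moreover have "gdelta_in (top_of_set M) (\<Inter>n. M \<inter> - wide (1 / Suc n))"
      by (intro gdelta_in_Inter) (auto intro!: open_imp_gdelta_in openin_open_Int closed_wide)
    ultimately have gdelta: "gdelta_in (top_of_set M) R"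
      by simp
    have f_R: "f x \<in> R" if x: "x \<in> R" for x
    proof -
      have xM: "x \<in> M"
        using x by (simp add: R_def)
      have "\<not> s < s'" if s: "s \<in> slopes (f x)" "s' \<in> slopes (f x)" for s s'
      proof -
        obtain t t' where t: "t \<in> slopes x" "slope_map x t = s" "t' \<in> slopes x" "slope_map x t'
            = s'"
          using slope_map_surj[OF xM s(1)] slope_map_surj[OF xM s(2)] by metis
        have "t' \<le> t"
          using x t by (auto simp: R_def not_less)
        then show ?thesis
          using slope_map_mono[OF xM t(3,1)] t(2,4) by simp
      qed
      then show ?thesis
        using f_M[OF xM] by (auto simp: R_def)
    qed
    have g_R: "g x \<in> R" if x: "x \<in> R" for x
    proof -
      have xM: "x \<in> M" "g x \<in> M"
        using x g_M by (simp_all add: R_def)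
      have "\<not> s < s'" if s: "s \<in> slopes (g x)" "s' \<in> slopes (g x)" for s s'
      proof -
        have "slope_map (g x) s \<in> slopes x" "slope_map (g x) s' \<in> slopes x"
          using slope_map_slopes(2)[OF xM(2) s(1)] slope_map_slopes(2)[OF xM(2) s(2)] fg[OF xM(1)]
              by simp_all
        then have "slope_map (g x) s' \<le> slope_map (g x) s"
          using x by (auto simp: R_def not_less)
        then show ?thesis
          using slope_map_mono[OF xM(2) s(2,1)] by simp
      qed
      then show ?thesis
        using xM(2) by (auto simp: R_def)
    qed
    have RM: "R \<subseteq> M" "closure R \<subseteq> M"
      using closure_minimal[OF _ compact_imp_closed[OF compact_M]] by (auto simp: R_def)
    have "f ` closure R \<subseteq> closure R"
      by (rule image_closure_subset[OF continuous_on_subset[OF continuous_f RM(2)] closed_closure])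
        (use f_R closure_subset[of R] in blast)
    moreover have "g ` closure R \<subseteq> closure R"
      by (rule image_closure_subset[OF continuous_on_subset[OF continuous_g RM(2)] closed_closure])
        (use g_R closure_subset[of R] in blast)
    moreover have "x = f (g x)" if "x \<in> closure R" for x
      using that RM(2) fg by force
    ultimately have "f ` closure R = closure R"
      by (metis image_subset_iff rev_image_eqI subsetI subset_antisym)
    then have "closure R = M"
      using False RM(2) by (intro minimal) auto
    then show ?thesis
      using gdelta Cone_subset_line by (intro disjI2 exI[of _ R]) (auto simp: R_def)
  qed
qed

section \<open>Lifts and differentials of maps of the annulus\<close>

lemma circle_proj_eq_iff: "circle_proj s = circle_proj t \<longleftrightarrow> s - t \<in> \<int>"
  by transfer simp

lemma circle_proj_surj: obtains t where "c = circle_proj t"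
  by transfer auto

lemma circle_diff_proj: "circle_diff (circle_proj s) (circle_proj t)
    = (s - t) - of_int (round (s - t))"
  by transfer simp

lemma annulus_proj_eq_iff: "annulus_proj z = annulus_proj w \<longleftrightarrow> (\<exists>k. z = w + (of_int k, 0))"
proof
  assume "annulus_proj z = annulus_proj w"
  then have "fst z - fst w \<in> \<int>" "snd z = snd w"
    by (auto simp: annulus_proj_def circle_proj_eq_iff)
  then show "\<exists>k. z = w + (of_int k, 0)"
    by (elim Ints_cases) (auto simp: prod_eq_iff algebra_simps)
qed (auto simp: annulus_proj_def circle_proj_eq_iff)

lemma annulus_proj_surj:
  fixes x :: annulus
  obtains z where "x = annulus_proj z"
  using circle_proj_surj[of "fst x"] unfolding annulus_proj_def
  by (metis fst_conv prod.collapse snd_conv)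

lemma dist_annulus: "dist x y = norm (annulus_diff x y)"
  by (simp add: dist_prod_def annulus_diff_def dist_circle_def norm_prod_def)
    (simp add: dist_real_def)

text \<open>Adding the representative difference to \<open>z\<close> selects a preimage of
  \<open>x\<close> within half a turn of \<open>z\<close>. This elementary local section of the
  covering replaces path lifting.\<close>

lemma annulus_proj_add_diff: "annulus_proj (z + annulus_diff x (annulus_proj z)) = x"
proof -
  obtain w where x: "x = annulus_proj w"
    by (rule annulus_proj_surj)
  have "z + annulus_diff x (annulus_proj z) = w + (of_int (- round (fst w - fst z)), 0)"
    by (simp add: x annulus_diff_def annulus_proj_def circle_diff_proj prod_eq_iff)
  then show ?thesis
    unfolding x annulus_proj_eq_iff by blast
qed

lemma annulus_diff_proj:
  assumes "\<bar>fst z - fst w\<bar> < 1 / 2"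
  shows "annulus_diff (annulus_proj z) (annulus_proj w) = z - w"
proof -
  have "round (fst z - fst w) = 0"
    using assms by (intro round_unique') simp
  then show ?thesis
    by (simp add: annulus_diff_def annulus_proj_def circle_diff_proj prod_eq_iff)
qed

lemma dist_annulus_proj_le: "dist (annulus_proj z) (annulus_proj w) \<le> dist z w"
proof -
  have "\<bar>circle_diff (circle_proj (fst z)) (circle_proj (fst w))\<bar> \<le> \<bar>fst z - fst w\<bar>"
    using round_diff_minimal[of "fst z - fst w" 0] by (simp add: circle_diff_proj)
  then show ?thesis
    by (simp add: dist_prod_def annulus_proj_def dist_circle_def dist_real_def flip:
        abs_le_square_iff)
qed

lemma continuous_annulus_proj: "continuous_on S annulus_proj"
  unfolding continuous_on_iff using dist_annulus_proj_le by (meson order_le_less_trans)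

lemma lift_tendsto:
  assumes "X \<longlonglongrightarrow> annulus_proj z"
  shows "(\<lambda>n. z + annulus_diff (X n) (annulus_proj z)) \<longlonglongrightarrow> z"
proof -
  have "(\<lambda>n. norm (annulus_diff (X n) (annulus_proj z))) \<longlonglongrightarrow> 0"
    using assms by (simp add: tendsto_dist_iff[of X] dist_annulus)
  then have "(\<lambda>n. z + annulus_diff (X n) (annulus_proj z)) \<longlonglongrightarrow> z + 0"
    by (intro tendsto_intros) (simp add: tendsto_norm_zero_iff)
  then show ?thesis
    by simp
qed

lemma continuous_on_annulus:
  fixes h :: "annulus \<Rightarrow> 'b::topological_space"
  assumes "continuous_on UNIV (\<lambda>z. h (annulus_proj z))"
  shows "continuous_on UNIV h"
  unfolding continuous_on_sequentially
proof (intro ballI allI impI, elim conjE)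
  fix X and x :: annulus assume X: "X \<longlonglongrightarrow> x"
  obtain z where x: "x = annulus_proj z"
    by (rule annulus_proj_surj)
  have "(\<lambda>n. z + annulus_diff (X n) (annulus_proj z)) \<longlonglongrightarrow> z"
    using X by (intro lift_tendsto) (simp add: x)
  then have "(\<lambda>n. h (annulus_proj (z + annulus_diff (X n) (annulus_proj z)))) \<longlonglongrightarrow> h (annulus_proj z)"
    by (rule continuous_on_tendsto_compose[OF assms]) auto
  then show "(h \<circ> X) \<longlonglongrightarrow> h x"
    by (simp add: annulus_proj_add_diff x o_def)
qed

lemma is_lift_continuous: "is_lift F f \<Longrightarrow> continuous_on UNIV F"
  unfolding is_lift_def by blast

lemma is_lift_apply: "is_lift F f \<Longrightarrow> annulus_proj (F z) = f (annulus_proj z)"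
  unfolding is_lift_def by blast

text \<open>At each point the two lifts differ by an integer; this integer depends continuously on a
  point of the connected plane.\<close>

lemma is_lift_unique:
  assumes "is_lift F f" "is_lift F' f"
  obtains k where "\<And>z. F' z = F z + (of_int k, 0)"
proof -
  have "\<exists>k. F' z = F z + (of_int k, 0)" for z
    using assms by (simp add: is_lift_apply flip: annulus_proj_eq_iff)
  then obtain k where k: "\<And>z. F' z = F z + (of_int (k z), 0)"
    by metis
  have "continuous_on UNIV (\<lambda>z. fst (F' z) - fst (F z))"
    by (intro continuous_intros is_lift_continuous[OF assms(1)] is_lift_continuous[OF assms(2)])
  then have "continuous_on UNIV (\<lambda>z. real_of_int (k z))"
    by (simp add: k)
  then have "(\<lambda>z. real_of_int (k z)) constant_on UNIV"
  proof (rule continuous_discrete_range_constant[rotated])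
    show "\<exists>e>0. \<forall>y. y \<in> UNIV \<and> real_of_int (k y) \<noteq> real_of_int (k z) \<longrightarrow>
        e \<le> norm (real_of_int (k y) - real_of_int (k z))" for z
    proof (intro exI[of _ 1] conjI allI impI)
      fix y assume "y \<in> UNIV \<and> real_of_int (k y) \<noteq> real_of_int (k z)"
      then have "1 \<le> \<bar>k y - k z\<bar>"
        by simp
      then show "1 \<le> norm (real_of_int (k y) - real_of_int (k z))"
        by (simp flip: of_int_diff of_int_abs)
    qed simp
  qed (simp add: convex_connected[OF convex_UNIV])
  then obtain y where y: "\<And>z. real_of_int (k z) = y"
    unfolding constant_on_def by blast
  have "k z = k 0" for z
    using y[of z] y[of 0] by simp
  then show thesis
    using that[of "k 0"] k by simp
qed

text \<open>Frees the differential from both arbitrary choices in its definition. The chosen lift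
  and base point differ from the given ones by integer translations in the target and the source,
  whose derivatives are the identity.\<close>

lemma annulus_deriv_eq:
  assumes "is_lift F f" "(F has_derivative D) (at z)"
  shows "annulus_deriv f (annulus_proj z) = D"
proof -
  define F0 where "F0 = (SOME F. is_lift F f)"
  define z0 where "z0 = (SOME w. annulus_proj w = annulus_proj z)"
  have F0: "is_lift F0 f"
    unfolding F0_def by (rule someI[of "\<lambda>F. is_lift F f", OF assms(1)])
  have "annulus_proj z0 = annulus_proj z"
    unfolding z0_def by (rule someI[of "\<lambda>w. annulus_proj w = annulus_proj z", OF refl])
  then obtain j where j: "z = z0 + (of_int j, 0)"
    using annulus_proj_eq_iff[of z z0] by metis
  have "is_lift (\<lambda>w. F (w + (of_int j, 0))) f"
    unfolding is_lift_def
  proof (intro conjI allI)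
    show "continuous_on UNIV (\<lambda>w. F (w + (of_int j, 0)))"
      by (rule continuous_on_compose2[OF is_lift_continuous[OF assms(1)] _ subset_UNIV]) (intro
          continuous_intros)
    show "annulus_proj (F (w + (of_int j, 0))) = f (annulus_proj w)" for w
      using is_lift_apply[OF assms(1)] annulus_proj_eq_iff[of "w + (of_int j, 0)" w] by metis
  qed
  then obtain k where k: "\<And>w. F0 w = F (w + (of_int j, 0)) + (of_int k, 0)"
    using is_lift_unique[OF _ F0] by blast
  have "((\<lambda>w. w + (of_int j, 0)) has_derivative id) (at z0)"
    by (auto intro!: derivative_eq_intros)
  then have "(F \<circ> (\<lambda>w. w + (of_int j, 0)) has_derivative D \<circ> id) (at z0)"
    by (rule diff_chain_at) (use assms(2) j in simp)
  then have "(F0 has_derivative D) (at z0)"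
    unfolding k[abs_def] using has_derivative_add_const by (auto simp: o_def)
  then show ?thesis
    unfolding annulus_deriv_def F0_def[symmetric] z0_def[symmetric]
    by (rule frechet_derivative_at[symmetric])
qed

lemma is_lift_pow:
  assumes "is_lift F f"
  shows "is_lift (F ^^ n) (f ^^ n)"
proof (induction n)
  case 0
  show ?case
    by (simp add: is_lift_def)
next
  case (Suc n)
  have "continuous_on UNIV (\<lambda>z. F ((F ^^ n) z))"
    by (rule continuous_on_compose2[OF is_lift_continuous[OF assms] is_lift_continuous[OF Suc.IH]
        subset_UNIV])
  moreover have "annulus_proj (F ((F ^^ n) z)) = f ((f ^^ n) (annulus_proj z))" for z
    by (simp only: is_lift_apply[OF assms] is_lift_apply[OF Suc.IH])
  ultimately show ?case
    by (simp add: is_lift_def o_def)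
qed

lemma has_derivative_funpow:
  assumes "\<And>z. (F has_derivative F' z) (at z)"
  shows "(F ^^ n has_derivative cocycle_pow F F' n z) (at z)"
proof (induction n arbitrary: z)
  case 0
  show ?case
    by (simp add: id_def)
next
  case (Suc n)
  have "(F ^^ n \<circ> F has_derivative cocycle_pow F F' n (F z) \<circ> F' z) (at z)"
    by (rule diff_chain_at[OF assms Suc.IH])
  then show ?case
    by (simp add: funpow_Suc_right o_def del: funpow.simps)
qed

lemma cocycle_pow_annulus:
  assumes "is_lift F f" "\<And>z. (F has_derivative F' z) (at z)"
  shows "cocycle_pow f (annulus_deriv f) n (annulus_proj z) v = cocycle_pow F F' n z v"
proof (induction n arbitrary: z v)
  case (Suc n)
  have "f (annulus_proj z) = annulus_proj (F z)"
    by (rule is_lift_apply[OF assms(1), symmetric])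
  then show ?case
    using Suc.IH[of "F z"] by (simp add: annulus_deriv_eq[OF assms])
qed simp

text \<open>The chain rule, carried out on the universal cover and then projected.\<close>

lemma annulus_deriv_pow:
  assumes "is_lift F f" "\<And>z. (F has_derivative F' z) (at z)"
  shows "annulus_deriv (f ^^ n) x v = cocycle_pow f (annulus_deriv f) n x v"
proof -
  obtain z where x: "x = annulus_proj z"
    by (rule annulus_proj_surj)
  show ?thesis
    unfolding x cocycle_pow_annulus[OF assms] annulus_deriv_eq[OF is_lift_pow[OF assms(1)]
        has_derivative_funpow[OF assms(2)]]
    by simp
qed

text \<open>Strict differentiability: both end points move, as paratingent vectors require.
  Differentiability at \<open>z\<close> alone would not suffice; the mean value inequality on a ball
  where \<open>F'\<close> is nearly constant gives the error bound.\<close>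

lemma C1_difference_quotient:
  fixes F :: "'a::real_normed_vector \<Rightarrow> 'b::real_normed_vector" and F' :: "'a \<Rightarrow> 'a \<Rightarrow>\<^sub>L 'b"
  assumes F': "\<And>z. (F has_derivative F' z) (at z)" "continuous_on UNIV F'"
    and Z: "Z \<longlonglongrightarrow> z" "W \<longlonglongrightarrow> z" and v: "(\<lambda>n. (Z n - W n) /\<^sub>R t n) \<longlonglongrightarrow> v"
  shows "(\<lambda>n. (F (Z n) - F (W n)) /\<^sub>R t n) \<longlonglongrightarrow> F' z v"
proof -
  define r where "r n = (F (Z n) - F (W n)) /\<^sub>R t n - F' z ((Z n - W n) /\<^sub>R t n)" for n
  obtain K where K: "0 < K" "\<And>n. norm ((Z n - W n) /\<^sub>R t n) \<le> K"
    using convergent_imp_bounded[OF v] unfolding bounded_pos by auto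
  have "r \<longlonglongrightarrow> 0"
  proof (rule tendstoI)
    fix e :: real assume e: "0 < e"
    define e' where "e' = e / (2 * K)"
    have "0 < e'"
      using e K(1) by (simp add: e'_def)
    moreover have "isCont F' z"
      using F'(2) by (simp add: continuous_on_eq_continuous_at)
    ultimately obtain d where d: "0 < d" "\<And>w. dist w z < d \<Longrightarrow> dist (F' w) (F' z) < e'"
      unfolding continuous_at_eps_delta by blast
    have "\<forall>\<^sub>F n in sequentially. Z n \<in> ball z d \<and> W n \<in> ball z d"
      using tendstoD[OF Z(1) d(1)] tendstoD[OF Z(2) d(1)] by eventually_elim (simp add:
          dist_commute)
    then show "\<forall>\<^sub>F n in sequentially. dist (r n) 0 < e"
    proof eventually_elim
      case (elim n)
      have "norm (F (Z n) - F (W n) - F' z (Z n - W n)) \<le> norm (Z n - W n) * e'"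
      proof (rule differentiable_bound_linearization)
        show "W n + s *\<^sub>R (Z n - W n) \<in> ball z d" if "s \<in> {0..1}" for s
        proof -
          have "(1 - s) *\<^sub>R W n + s *\<^sub>R Z n \<in> ball z d"
            using that elim by (intro convexD convex_ball) auto
          then show ?thesis
            by (simp add: algebra_simps)
        qed
        show "(F has_derivative F' x) (at x within ball z d)" for x
          using F'(1) by (rule has_derivative_at_withinI)
        show "onorm (blinfun_apply (F' x) - blinfun_apply (F' z)) \<le> e'" if "x \<in> ball z d" for x
        proof -
          have "blinfun_apply (F' x) - blinfun_apply (F' z) = blinfun_apply (F' x - F' z)"
            by (auto simp: blinfun.diff_left)
          then show ?thesis
            using d(2)[of x] that by (simp add: norm_blinfun.rep_eq[symmetric] dist_norm
                norm_minus_commute dist_commute)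
        qed
        show "z \<in> ball z d"
          using d(1) by simp
      qed
      then have "\<bar>inverse (t n)\<bar> * norm (F (Z n) - F (W n) - F' z (Z n - W n))
          \<le> \<bar>inverse (t n)\<bar> * (norm (Z n - W n) * e')"
        by (intro mult_left_mono) auto
      moreover have "r n = inverse (t n) *\<^sub>R (F (Z n) - F (W n) - F' z (Z n - W n))"
        by (simp add: r_def blinfun.scaleR_right blinfun.diff_right scaleR_diff_right)
      ultimately have "norm (r n) \<le> norm ((Z n - W n) /\<^sub>R t n) * e'"
        by (simp only: norm_scaleR mult.assoc)
      also have "\<dots> \<le> K * e'"
        using K(2) \<open>0 < e'\<close> by (intro mult_right_mono) auto
      also have "\<dots> < e"
        using e K(1) by (simp add: e'_def)
      finally show ?case
        by simp
    qed
  qed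
  moreover have "(\<lambda>n. F' z ((Z n - W n) /\<^sub>R t n)) \<longlonglongrightarrow> F' z v"
    by (intro tendsto_intros v)
  ultimately have "(\<lambda>n. r n + F' z ((Z n - W n) /\<^sub>R t n)) \<longlonglongrightarrow> 0 + F' z v"
    by (rule tendsto_add)
  then show ?thesis
    by (simp add: r_def)
qed

section \<open>Area preservation and the twist condition\<close>

text \<open>The mean value theorem, applied on the segment along \<open>v\<close> to the difference
  of \<open>h\<close> at two points that are \<open>u\<close> apart, leaves a difference of two
  values of \<omega>. Additivity reduces their linear parts to \<open>b u v\<close>.\<close>

lemma second_difference_bound:
  fixes h :: "'a::real_normed_vector \<Rightarrow> real"
  assumes deriv: "\<And>w. (h has_derivative \<omega> w) (at w)"
    and bound: "\<And>w v. norm (w - z) < d \<Longrightarrow> \<bar>\<omega> w v - b (w - z) v\<bar> \<le> e * norm (w - z) * norm v"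
    and b: "\<And>u u' v. b (u + u') v = b u v + b u' v" and e: "0 \<le> e"
    and uv: "norm u + norm v < d"
  shows "\<bar>(h (z + u + v) - h (z + u) - h (z + v) + h z) - b u v\<bar>
      \<le> 2 * e * (norm u + norm v) * norm v"
proof -
  define \<psi> where "\<psi> s = h (z + u + s *\<^sub>R v) - h (z + s *\<^sub>R v)" for s :: real
  define \<psi>' where "\<psi>' s t = \<omega> (z + u + s *\<^sub>R v) (t *\<^sub>R v) - \<omega> (z + s *\<^sub>R v) (t *\<^sub>R v)" for s t ::
      real
  have \<psi>': "(\<psi> has_derivative \<psi>' s) (at s within {0..1})" for s
  proof -
    have line: "((\<lambda>s. y + s *\<^sub>R v) has_derivative (\<lambda>t. t *\<^sub>R v)) (at s within {0..1})" for y
      by (auto intro!: derivative_eq_intros)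
    have "((\<lambda>s. h (y + s *\<^sub>R v)) has_derivative (\<lambda>t. \<omega> (y + s *\<^sub>R v) (t *\<^sub>R v))) (at s within
        {0..1})" for y
      by (rule has_derivative_compose[OF line deriv])
    then show ?thesis
      unfolding \<psi>_def \<psi>'_def by (intro has_derivative_diff)
  qed
  have "\<exists>s\<in>{0<..<1}. \<psi> 1 - \<psi> 0 = \<psi>' s (1 - 0)"
    by (rule mvt_simple) (simp_all add: \<psi>')
  then obtain s where s: "s \<in> {0<..<1}" "\<psi> 1 - \<psi> 0 = \<omega> (z + u + s *\<^sub>R v) v - \<omega> (z + s *\<^sub>R v) v"
    unfolding \<psi>'_def by auto
  have sv: "norm (s *\<^sub>R v) \<le> norm v"
    using s(1) by (simp add: mult_left_le_one_le)
  then have usv: "norm (u + s *\<^sub>R v) \<le> norm u + norm v"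
    using norm_triangle_ineq[of u "s *\<^sub>R v"] by linarith
  have "\<bar>\<omega> (z + y) v - b y v\<bar> \<le> e * (norm u + norm v) * norm v" if "norm y \<le> norm u + norm v" for y
  proof -
    have "\<bar>\<omega> (z + y) v - b y v\<bar> \<le> e * norm y * norm v"
      using bound[of "z + y" v] that uv by simp
    also have "\<dots> \<le> e * (norm u + norm v) * norm v"
      using that e by (intro mult_right_mono mult_left_mono) auto
    finally show ?thesis .
  qed
  moreover have "norm (s *\<^sub>R v) \<le> norm u + norm v"
    using sv norm_ge_zero[of u] by linarith
  ultimately have
    "\<bar>\<omega> (z + u + s *\<^sub>R v) v - b (u + s *\<^sub>R v) v\<bar> \<le> e * (norm u + norm v) * norm v"
    "\<bar>\<omega> (z + s *\<^sub>R v) v - b (s *\<^sub>R v) v\<bar> \<le> e * (norm u + norm v) * norm v"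
    using usv by (simp_all only: add.assoc)
  moreover have "h (z + u + v) - h (z + u) - h (z + v) + h z = \<psi> 1 - \<psi> 0"
    by (simp add: \<psi>_def)
  ultimately show ?thesis
    unfolding s(2) b by linarith
qed

text \<open>Schwarz's theorem for a first derivative that is differentiable at the single point
  \<open>z\<close>. The second difference is symmetric in \<open>u\<close> and \<open>v\<close>, and
  after scaling both by \<open>s\<close> its error is small compared with the square of
  \<open>s\<close>.\<close>

lemma second_derivative_symmetric_at:
  fixes h :: "'a::real_normed_vector \<Rightarrow> real"
  assumes deriv: "\<And>w. (h has_derivative \<omega> w) (at w)"
    and bound: "\<And>e. 0 < e \<Longrightarrow> \<exists>d>0. \<forall>w v. norm (w - z) < d
        \<longrightarrow> \<bar>\<omega> w v - b (w - z) v\<bar> \<le> e * norm (w - z) * norm v"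
    and add: "\<And>u u' v. b (u + u') v = b u v + b u' v"
    and scale: "\<And>s u v. b (s *\<^sub>R u) (s *\<^sub>R v) = s\<^sup>2 * b u v"
  shows "b u v = b v u"
proof (rule ccontr)
  assume ne: "b u v \<noteq> b v u"
  define N where "N = norm u + norm v"
  \<comment> \<open>Chosen so that \<open>2 * e * (2 * N\<^sup>2 + 1)\<close> is exactly the
    supposed gap, while the estimate below gives at most \<open>2 * e * N\<^sup>2\<close>. The
    summand 1 keeps the divisor positive.\<close>
  define e where "e = \<bar>b u v - b v u\<bar> / 2 / (2 * N\<^sup>2 + 1)"
  have N: "0 \<le> N" "0 < 2 * N\<^sup>2 + 1"
    by (simp_all add: N_def add_nonneg_pos)
  have e: "0 < e"
    using ne N(2) by (simp add: e_def)
  obtain d where d: "0 < d" "\<And>w v. norm (w - z) < d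
      \<Longrightarrow> \<bar>\<omega> w v - b (w - z) v\<bar> \<le> e * norm (w - z) * norm v"
    using bound[OF e] by blast
  define s where "s = d / 2 / (N + 1)"
  have s: "0 < s" "s * N < d"
  proof -
    show "0 < s"
      using N(1) d(1) by (simp add: s_def)
    have "s * (N + 1) = d / 2"
      using iffD1[OF nonzero_eq_divide_eq s_def] N(1) by linarith
    then show "s * N < d"
      using \<open>0 < s\<close> d(1) by (simp add: distrib_left)
  qed
  have sN: "norm (s *\<^sub>R u) + norm (s *\<^sub>R v) = s * N"
    using s(1) by (simp add: N_def algebra_simps)
  have sN': "norm (s *\<^sub>R v) + norm (s *\<^sub>R u) = s * N"
    using sN by (simp only: add.commute)
  have lt: "norm (s *\<^sub>R u) + norm (s *\<^sub>R v) < d" "norm (s *\<^sub>R v) + norm (s *\<^sub>R u) < d"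
    using s(2) by (simp_all only: sN sN')
  have "\<bar>(h (z + s *\<^sub>R u + s *\<^sub>R v) - h (z + s *\<^sub>R u) - h (z + s *\<^sub>R v) + h z) - s\<^sup>2 * b u v\<bar>
      \<le> 2 * e * (s * N) * norm (s *\<^sub>R v)"
    by (rule second_difference_bound[where u = "s *\<^sub>R u" and v = "s *\<^sub>R v" and b = b,
          OF deriv d(2) add less_imp_le[OF e] lt(1), unfolded sN scale])
  moreover have "\<bar>(h (z + s *\<^sub>R v + s *\<^sub>R u) - h (z + s *\<^sub>R v) - h (z + s *\<^sub>R u) + h z) - s\<^sup>2 * b v
      u\<bar> \<le> 2 * e * (s * N) * norm (s *\<^sub>R u)"
    by (rule second_difference_bound[where u = "s *\<^sub>R v" and v = "s *\<^sub>R u" and b = b,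
          OF deriv d(2) add less_imp_le[OF e] lt(2), unfolded sN' scale])
  then have "\<bar>(h (z + s *\<^sub>R u + s *\<^sub>R v) - h (z + s *\<^sub>R v) - h (z + s *\<^sub>R u) + h z) - s\<^sup>2 * b v u\<bar>
      \<le> 2 * e * (s * N) * norm (s *\<^sub>R u)"
    by (simp only: add.assoc add.commute[of "s *\<^sub>R v"])
  ultimately have "\<bar>s\<^sup>2 * b u v - s\<^sup>2 * b v u\<bar>
      \<le> 2 * e * (s * N) * norm (s *\<^sub>R v) + 2 * e * (s * N) * norm (s *\<^sub>R u)"
    by linarith
  also have "\<dots> = 2 * e * (s * N) * (norm (s *\<^sub>R u) + norm (s *\<^sub>R v))"
    by (simp only: distrib_left add.commute)
  also have "\<dots> = s\<^sup>2 * (2 * e * N\<^sup>2)"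
    unfolding sN by (simp add: power2_eq_square)
  also have "\<bar>s\<^sup>2 * b u v - s\<^sup>2 * b v u\<bar> = s\<^sup>2 * \<bar>b u v - b v u\<bar>"
    by (simp add: abs_mult flip: right_diff_distrib)
  finally have "\<bar>b u v - b v u\<bar> \<le> 2 * e * N\<^sup>2"
    using s(1) by simp
  also have "\<dots> < 2 * e * (2 * N\<^sup>2 + 1)"
    using e by (intro mult_strict_left_mono) (auto intro: add_strict_increasing2)
  also have "\<dots> = \<bar>b u v - b v u\<bar>"
    using iffD1[OF nonzero_eq_divide_eq e_def] N(2) by (simp only: mult.assoc) simp
  finally show False
    by simp
qed

definition jacobian :: "(real \<times> real \<Rightarrow> real \<times> real) \<Rightarrow> real"
  where "jacobian T = fst (T (1, 0)) * snd (T (0, 1)) - fst (T (0, 1)) * snd (T (1, 0))"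

lemma linear_real2_eq:
  fixes T :: "real \<times> real \<Rightarrow> real \<times> real"
  assumes "linear T"
  shows "T v = (fst (T (1, 0)) * fst v + fst (T (0, 1)) * snd v, snd (T (1, 0)) * fst v + snd (T (0,
      1)) * snd v)"
proof -
  have "T v = T (fst v *\<^sub>R (1, 0) + snd v *\<^sub>R (0, 1))"
    by simp
  also have "\<dots> = fst v *\<^sub>R T (1, 0) + snd v *\<^sub>R T (0, 1)"
    by (simp only: linear_add[OF assms] linear_scale[OF assms])
  finally show ?thesis
    by (simp add: prod_eq_iff mult.commute)
qed

lemma jacobian_compose:
  assumes "linear S" "linear T"
  shows "jacobian (S \<circ> T) = jacobian S * jacobian T"
proof -
  define s t where "s = S (1, 0)" and "t = S (0, 1)"
  have S: "S v = (fst s * fst v + fst t * snd v, snd s * fst v + snd t * snd v)" for v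
    unfolding s_def t_def by (rule linear_real2_eq[OF assms(1)])
  have "jacobian S = fst s * snd t - fst t * snd s"
    by (simp add: jacobian_def s_def t_def)
  then show ?thesis
    by (simp add: jacobian_def S algebra_simps)
qed

lemma jacobian_id: "jacobian id = 1"
  by (simp add: jacobian_def)

lemma abs_fst_le_norm: "\<bar>fst p\<bar> \<le> norm p" and abs_snd_le_norm: "\<bar>snd p\<bar> \<le> norm p"
  for p :: "real \<times> real"
  using norm_fst_le[of "fst p" "snd p"] norm_snd_le[of "snd p" "fst p"] by simp_all

text \<open>The primitive of the pulled back form minus r dtheta has symmetric second derivative
  once it is corrected at \<open>z\<close>. Symmetry on the two coordinate vectors is precisely the
  determinant identity.\<close>

lemma exact_symplectic_jacobian:
  fixes F' :: "real \<times> real \<Rightarrow> (real \<times> real) \<Rightarrow>\<^sub>L (real \<times> real)"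
  assumes "exact_symplectic f" and lift: "is_lift F f"
    and F': "\<And>z. (F has_derivative F' z) (at z)" "continuous_on UNIV F'"
  shows "jacobian (F' z) = 1"
proof -
  obtain S where S: "\<And>w. ((\<lambda>w. S (annulus_proj w)) has_derivative
      (\<lambda>v. snd (f (annulus_proj w)) * fst (annulus_deriv f (annulus_proj w) v) - snd w * fst v)) (at
          w)"
    using assms(1) unfolding exact_symplectic_def by blast
  have S': "((\<lambda>w. S (annulus_proj w)) has_derivative (\<lambda>v. snd (F w) * fst (F' w v) - snd w * fst v))
      (at w)" for w
  proof -
    have "snd (f (annulus_proj w)) = snd (F w)"
      unfolding is_lift_apply[OF lift, symmetric] by (simp add: annulus_proj_def)
    then show ?thesis
      using S[of w] by (simp add: annulus_deriv_eq[OF lift F'(1)])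
  qed
  \<comment> \<open>The correction makes both coefficients of its differential \<omega> vanish at
    \<open>z\<close>. Hence \<omega> is differentiable there, with linear part \<open>b\<close>,
    although \<open>F'\<close> is only continuous.\<close>
  define h where "h w = S (annulus_proj w) - (snd (F z) * fst (F w) - snd z * fst w)" for w
  define \<omega> where "\<omega> w v = (snd (F w) - snd (F z)) * fst (F' w v) - (snd w - snd z) * fst v" for w v
  define b where "b u v = snd (F' z u) * fst (F' z v) - snd u * fst v" for u v
  have "b (1, 0) (0, 1) = b (0, 1) (1, 0)"
  proof (rule second_derivative_symmetric_at[where h = h and \<omega> = \<omega> and z = z and b = b])
    show "(h has_derivative \<omega> w) (at w)" for w
    proof -
      have "(h has_derivative (\<lambda>v. (snd (F w) * fst (F' w v) - snd w * fst v) -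
          (snd (F z) * fst (F' w v) - snd z * fst v))) (at w)"
        unfolding h_def
        by (intro has_derivative_diff S' has_derivative_mult_right has_derivative_fst F'(1)
            has_derivative_ident)
      then show ?thesis
        by (simp add: \<omega>_def[abs_def] algebra_simps)
    qed
    show "b (u + u') v = b u v + b u' v" for u u' v
      by (simp add: b_def blinfun.add_right algebra_simps)
    show "b (s *\<^sub>R u) (s *\<^sub>R v) = s\<^sup>2 * b u v" for s u v
      by (simp add: b_def blinfun.scaleR_right power2_eq_square algebra_simps)
    fix e :: real assume e: "0 < e"
    define K where "K = norm (F' z) + 1"
    have K: "0 < K" "norm (F' z) \<le> K"
      by (simp_all add: K_def add_nonneg_pos)
    \<comment> \<open>The bound 1 keeps \<open>norm (F' w)\<close> below \<open>K\<close>; the other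
      bound makes each of the two error terms of the product at most half of the allowed
      one.\<close>
    define e' where "e' = min 1 (e / (2 * K))"
    have e': "0 < e'" "e' \<le> 1" "e' * K \<le> e / 2"
    proof -
      show "0 < e'" "e' \<le> 1"
        using e K(1) by (simp_all add: e'_def)
      have "e' * K \<le> e / (2 * K) * K"
        using K(1) by (intro mult_right_mono) (simp_all add: e'_def)
      then show "e' * K \<le> e / 2"
        using K(1) by simp
    qed
    obtain d1 where d1: "0 < d1" "\<And>w. norm (w - z) < d1
        \<Longrightarrow> norm (F w - F z - F' z (w - z)) \<le> e' * norm (w - z)"
      using F'(1)[of z] e'(1) unfolding has_derivative_at_alt by blast
    obtain d2 where d2: "0 < d2" "\<And>w. norm (w - z) < d2 \<Longrightarrow> norm (F' w - F' z) < e'"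
      using F'(2) e'(1) unfolding continuous_on_eq_continuous_at[OF open_UNIV]
          continuous_at_eps_delta dist_norm by blast
    have "\<bar>\<omega> w v - b (w - z) v\<bar> \<le> e * norm (w - z) * norm v" if w: "norm (w - z) < d1"
        "norm (w - z) < d2" for w v
    proof -
      have 1: "\<bar>snd (F w - F z - F' z (w - z))\<bar> \<le> e' * norm (w - z)"
        by (rule order_trans[OF abs_snd_le_norm d1(2)[OF w(1)]])
      have "norm (F' w) \<le> norm (F' z) + norm (F' w - F' z)"
        using norm_triangle_ineq[of "F' z" "F' w - F' z"] by simp
      then have w_le: "norm (F' w) \<le> K"
        using d2(2)[OF w(2)] e'(2) by (simp add: K_def)
      have 2: "\<bar>fst (F' w v)\<bar> \<le> K * norm v"
        by (rule order_trans[OF abs_fst_le_norm order_trans[OF norm_blinfun mult_right_mono[OF w_le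
            norm_ge_zero]]])
      have 3: "\<bar>snd (F' z (w - z))\<bar> \<le> K * norm (w - z)"
        by (rule order_trans[OF abs_snd_le_norm order_trans[OF norm_blinfun mult_right_mono[OF K(2)
            norm_ge_zero]]])
      have 4: "\<bar>fst ((F' w - F' z) v)\<bar> \<le> e' * norm v"
        by (rule order_trans[OF abs_fst_le_norm order_trans[OF norm_blinfun
              mult_right_mono[OF less_imp_le[OF d2(2)[OF w(2)]] norm_ge_zero]]])
      have "\<omega> w v - b (w - z) v =
        snd (F w - F z - F' z (w - z)) * fst (F' w v) + snd (F' z (w - z)) * fst ((F' w - F' z) v)"
        by (simp add: \<omega>_def b_def blinfun.diff_left algebra_simps)
      also have "\<bar>\<dots>\<bar> \<le> (e' * norm (w - z)) * (K * norm v) + (K * norm (w - z)) * (e' * norm v)"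
        by (rule order_trans[OF abs_triangle_ineq], unfold abs_mult)
          (intro add_mono mult_mono 1 2 3 4; use e'(1) K(1) in simp)
      also have "\<dots> = 2 * (e' * K) * (norm (w - z) * norm v)"
        by simp
      also have "\<dots> \<le> e * (norm (w - z) * norm v)"
        using e'(3) by (intro mult_right_mono) auto
      finally show ?thesis
        by (simp add: mult.assoc)
    qed
    then show "\<exists>d>0. \<forall>w v. norm (w - z) < d \<longrightarrow> \<bar>\<omega> w v - b (w - z) v\<bar> \<le> e * norm (w - z) * norm v"
      using d1(1) d2(1) by (intro exI[of _ "min d1 d2"]) auto
  qed
  then show ?thesis
    by (simp add: b_def jacobian_def algebra_simps)
qed

text \<open>Monotonicity alone gives a nonnegative derivative; a zero is excluded by the chain rule
  for the differentiable inverse.\<close>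

lemma C1_diffeo_deriv_pos:
  fixes \<phi> :: "real \<Rightarrow> real"
  assumes "C1_diffeo \<phi>" "strict_mono \<phi>" "(\<phi> has_real_derivative m) (at r)"
  shows "0 < m"
proof -
  have bij: "bij \<phi>"
    using assms(1) by (simp add: C1_diffeo_def)
  obtain \<psi>' where \<psi>': "(inv \<phi> has_derivative \<psi>') (at (\<phi> r))"
    using assms(1) unfolding C1_diffeo_def C1_map_def by blast
  have "((\<lambda>x. inv \<phi> (\<phi> x)) has_derivative (\<lambda>t. \<psi>' (m * t))) (at r)"
    by (rule has_derivative_compose[OF assms(3)[unfolded has_field_derivative_def] \<psi>'])
  moreover have "(\<lambda>x. inv \<phi> (\<phi> x)) = (\<lambda>x. x)"
    using bij by (simp add: bij_is_inj)
  ultimately have "((\<lambda>x. x) has_derivative (\<lambda>t. \<psi>' (m * t))) (at r)"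
    by simp
  from fun_cong[OF has_derivative_unique[OF this has_derivative_ident], of 1] have "\<psi>' m = 1"
    by simp
  moreover have "\<psi>' 0 = 0"
    by (rule linear_0[OF has_derivative_linear[OF \<psi>']])
  ultimately have "m \<noteq> 0"
    by auto
  moreover have "0 \<le> m"
    by (rule mono_on_imp_deriv_nonneg[OF _ assms(3), of UNIV])
      (simp_all add: assms(2) mono_on_subset strict_mono_mono)
  ultimately show ?thesis
    by simp
qed

lemma positive_twist_deriv_pos:
  assumes "positive_twist_map f" "is_lift F f" "\<And>z. (F has_derivative F' z) (at z)"
  shows "0 < fst (F' z (0, 1))"
proof (rule C1_diffeo_deriv_pos)
  show "C1_diffeo (\<lambda>r. fst (F (fst z, r)))" "strict_mono (\<lambda>r. fst (F (fst z, r)))"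
    using assms(1,2) unfolding positive_twist_map_def by blast+
  have "((\<lambda>r. (fst z, r)) has_derivative (\<lambda>t. (0, t))) (at (snd z))"
    by (auto intro!: derivative_eq_intros)
  then have "((\<lambda>r. fst (F (fst z, r))) has_derivative (\<lambda>t. fst (F' z (0, t)))) (at (snd z))"
    using has_derivative_fst[OF has_derivative_compose[of "Pair (fst z)" "Pair 0" "snd z" UNIV F
        "F' z"]] assms(3)[of z]
    by simp
  moreover have "(\<lambda>t. fst (F' z (0, t))) = (*) (fst (F' z (0, 1)))"
    by (rule ext, subst linear_real2_eq[OF has_derivative_linear[OF assms(3)]]) simp
  ultimately show "((\<lambda>r. fst (F (fst z, r))) has_real_derivative fst (F' z (0, 1))) (at (snd z))"
    by (simp only: has_field_derivative_def)
qed

text \<open>The lift \<open>G\<close> of the inverse is normalised to be the exact inverse of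
  \<open>F\<close>, not merely up to an integer translation, so that backward iterates upstairs
  retrace forward ones.\<close>

locale annulus_lift =
  fixes f :: "annulus \<Rightarrow> annulus" and F G :: "real \<times> real \<Rightarrow> real \<times> real"
    and F' G' :: "real \<times> real \<Rightarrow> (real \<times> real) \<Rightarrow>\<^sub>L (real \<times> real)"
  assumes bij: "bij f" and lift_F: "is_lift F f" and lift_G: "is_lift G (inv f)"
    and F': "(F has_derivative F' z) (at z)" "continuous_on UNIV F'"
    and G': "(G has_derivative G' z) (at z)" "continuous_on UNIV G'"
    and FG: "F (G z) = z" and GF: "G (F z) = z" and jacobian_F': "jacobian (F' z) = 1"
begin

lemma G'_F': "G' (F z) (F' z v) = v"
proof -
  have "((\<lambda>z. G (F z)) has_derivative (\<lambda>v. G' (F z) (F' z v))) (at z)"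
    by (rule has_derivative_compose[OF F'(1) G'(1)])
  then have "((\<lambda>z. z) has_derivative (\<lambda>v. G' (F z) (F' z v))) (at z)"
    by (simp only: GF)
  from fun_cong[OF has_derivative_unique[OF this has_derivative_ident], of v] show ?thesis .
qed

lemma linear_F': "linear (F' z)" and linear_G': "linear (G' z)"
  by (simp_all add: blinfun.bounded_linear_right bounded_linear.linear)

text \<open>This symmetry supplies every statement about backward iterates, and the case of negative
  twist maps.\<close>

lemma annulus_lift_inv: "annulus_lift (inv f) G F G' F'"
proof
  show "bij (inv f)"
    by (rule bij_imp_bij_inv[OF bij])
  show "is_lift F (inv (inv f))"
    using lift_F by (simp add: inv_inv_eq[OF bij])
  show "jacobian (G' z) = 1" for z
  proof -
    have "G' z \<circ> F' (G z) = id"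
      using G'_F'[of "G z"] by (auto simp: FG)
    then have "jacobian (G' z) * jacobian (F' (G z)) = 1"
      by (metis jacobian_compose linear_F' linear_G' jacobian_id)
    then show ?thesis
      by (simp add: jacobian_F')
  qed
qed (simp_all add: F' G' FG GF lift_G)

lemma deriv_f: "annulus_deriv f (annulus_proj z) = F' z"
  and deriv_inv_f: "annulus_deriv (inv f) (annulus_proj z) = G' z"
  by (rule annulus_deriv_eq[OF lift_F F'(1)] annulus_deriv_eq[OF lift_G G'(1)])+

lemma continuous_f: "continuous_on UNIV f"
proof (rule continuous_on_annulus)
  have "continuous_on UNIV (\<lambda>z. annulus_proj (F z))"
    by (rule continuous_on_compose2[OF continuous_annulus_proj is_lift_continuous[OF lift_F]
        subset_UNIV])
  then show "continuous_on UNIV (\<lambda>z. f (annulus_proj z))"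
    by (simp only: is_lift_apply[OF lift_F])
qed

lemma continuous_deriv: "continuous_on UNIV (\<lambda>x. annulus_deriv f x v)"
  by (rule continuous_on_annulus) (unfold deriv_f, intro continuous_intros F'(2))

lemma twist_cocycle:
  assumes M: "compact M" "M \<noteq> {}" "f ` M = M" and twist: "\<And>z. 0 < fst (F' z (0, 1))"
  shows "twist_cocycle M f (inv f) (annulus_deriv f) (annulus_deriv (inv f))
    (\<lambda>x. fst (annulus_deriv f x (1, 0))) (\<lambda>x. fst (annulus_deriv f x (0, 1)))
    (\<lambda>x. snd (annulus_deriv f x (1, 0))) (\<lambda>x. snd (annulus_deriv f x (0, 1)))"
proof
  show "compact M" "M \<noteq> {}"
    by (fact M)+
  show "f x \<in> M" if "x \<in> M" for x
    using that M(3) by blast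
  show "inv f x \<in> M" if "x \<in> M" for x
    using that M(3) bij by (metis bij_inv_eq_iff image_iff)
  show "inv f (f x) = x" "f (inv f x) = x" for x
    using bij by (simp_all add: bij_def surj_f_inv_f)
  show "continuous_on M f"
    by (rule continuous_on_subset[OF continuous_f subset_UNIV])
  show "continuous_on M (inv f)"
    by (rule continuous_on_subset[OF annulus_lift.continuous_f[OF annulus_lift_inv] subset_UNIV])
  note cont = continuous_on_subset[OF continuous_deriv subset_UNIV]
  show "continuous_on M (\<lambda>x. fst (annulus_deriv f x (1, 0)))"
      "continuous_on M (\<lambda>x. fst (annulus_deriv f x (0, 1)))"
    "continuous_on M (\<lambda>x. snd (annulus_deriv f x (1, 0)))"
        "continuous_on M (\<lambda>x. snd (annulus_deriv f x (0, 1)))"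
    by (intro continuous_on_fst continuous_on_snd cont)+
  fix x v
  obtain z where x: "x = annulus_proj z"
    by (rule annulus_proj_surj)
  show "annulus_deriv f x v = (fst (annulus_deriv f x (1, 0)) * fst v + fst (annulus_deriv f x (0,
      1)) * snd v,
      snd (annulus_deriv f x (1, 0)) * fst v + snd (annulus_deriv f x (0, 1)) * snd v)"
    unfolding x deriv_f by (rule linear_real2_eq[OF linear_F'])
  show "annulus_deriv (inv f) (f x) (annulus_deriv f x v) = v"
    unfolding x is_lift_apply[OF lift_F, symmetric] deriv_f deriv_inv_f by (rule G'_F')
  show "fst (annulus_deriv f x (1, 0)) * snd (annulus_deriv f x (0, 1)) -
      fst (annulus_deriv f x (0, 1)) * snd (annulus_deriv f x (1, 0)) = 1"
    using jacobian_F'[of z] by (simp add: jacobian_def x deriv_f)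
  show "0 < fst (annulus_deriv f x (0, 1))"
    unfolding x deriv_f by (rule twist)
qed

lemma uniformly_hyperbolic:
  assumes "compact M" "f ` M = M"
    and "hyperbolic_cocycle M f (inv f) (annulus_deriv f) (annulus_deriv (inv f))"
  shows "uniformly_hyperbolic f M"
proof -
  obtain Es Eu P C c where P: "\<And>v. continuous_on M (\<lambda>x. blinfun_apply (P x) v)"
    and C: "0 < C" "0 < c" "c < 1"
    and split: "\<And>x. x \<in> M \<Longrightarrow> hyperbolic_splitting f (inv f) (annulus_deriv f) (annulus_deriv (inv f))
        C c Es Eu (P x) x"
    using assms(3) unfolding hyperbolic_cocycle_def by blast
  \<comment> \<open>Continuity for each fixed vector is continuity into the product topology on
    functions.\<close>
  have cont: "continuous_on M (\<lambda>x. blinfun_apply (P x))"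
    using P by (rule continuous_on_coordinatewise_then_product)
  have pow: "annulus_deriv (f ^^ n) x = cocycle_pow f (annulus_deriv f) n x"
    "annulus_deriv (inv f ^^ n) x = cocycle_pow (inv f) (annulus_deriv (inv f)) n x" for n x
    by (rule ext annulus_deriv_pow[OF lift_F F'(1)] annulus_deriv_pow[OF lift_G G'(1)])+
  show ?thesis
    unfolding uniformly_hyperbolic_def pow
    by (intro conjI assms(1,2), rule exI[of _ Es], rule exI[of _ Eu], rule exI[of _ P], rule exI[of
        _ C],
        rule exI[of _ c])
      (use cont C split in \<open>simp add: hyperbolic_splitting_def\<close>)
qed

lemma f_M_iff:
  assumes "f ` M = M"
  shows "annulus_proj (F z) \<in> M \<longleftrightarrow> annulus_proj z \<in> M" "annulus_proj (G z) \<in> M \<longleftrightarrow> annulus_proj z \<in> M"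
proof -
  have *: "annulus_proj (F w) \<in> M \<longleftrightarrow> annulus_proj w \<in> M" for w
    unfolding is_lift_apply[OF lift_F] using assms bij inj_image_mem_iff by (metis bij_is_inj)
  show "annulus_proj (F z) \<in> M \<longleftrightarrow> annulus_proj z \<in> M" "annulus_proj (G z) \<in> M \<longleftrightarrow> annulus_proj z \<in> M"
    using *[of z] *[of "G z"] by (simp_all add: FG)
qed

text \<open>Since the order hypothesis is an equivalence, its negation transports the weak
  inequality, and reading it at preimages gives the same for \<open>G\<close>.\<close>

lemma ordered_pow:
  assumes M: "f ` M = M"
    and order: "\<And>z w. annulus_proj z \<in> M \<Longrightarrow> annulus_proj w \<in> M
        \<Longrightarrow> fst z < fst w \<longleftrightarrow> fst (F z) < fst (F w)"
    and zw: "annulus_proj z \<in> M" "annulus_proj w \<in> M" "fst w \<le> fst z"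
  shows "fst ((F ^^ n) w) \<le> fst ((F ^^ n) z) \<and> fst ((G ^^ n) w) \<le> fst ((G ^^ n) z)"
proof -
  have "annulus_proj ((F ^^ n) z) \<in> M \<and> annulus_proj ((F ^^ n) w) \<in> M \<and> fst ((F ^^ n) w)
      \<le> fst ((F ^^ n) z)"
  proof (induction n)
    case (Suc n)
    then show ?case
      using order[of "(F ^^ n) z" "(F ^^ n) w"] by (simp add: f_M_iff[OF M])
  qed (use zw in simp)
  moreover have "annulus_proj ((G ^^ n) z) \<in> M \<and> annulus_proj ((G ^^ n) w) \<in> M \<and> fst ((G ^^ n) w)
      \<le> fst ((G ^^ n) z)"
  proof (induction n)
    case (Suc n)
    then show ?case
      using order[of "G ((G ^^ n) z)" "G ((G ^^ n) w)"] by (simp add: f_M_iff[OF M] FG)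
  qed (use zw in simp)
  ultimately show ?thesis
    by blast
qed

lemma pow_difference_quotient:
  assumes "Z \<longlonglongrightarrow> z" "W \<longlonglongrightarrow> z" "(\<lambda>n. (Z n - W n) /\<^sub>R t n) \<longlonglongrightarrow> v"
  shows "(\<lambda>n. ((F ^^ k) (Z n) - (F ^^ k) (W n)) /\<^sub>R t n) \<longlonglongrightarrow> cocycle_pow F F' k z v"
  using assms
proof (induction k arbitrary: Z W z v)
  case (Suc k)
  have F_lim: "(\<lambda>n. F (X n)) \<longlonglongrightarrow> F z" if "X \<longlonglongrightarrow> z" for X
    using continuous_on_tendsto_compose[OF is_lift_continuous[OF lift_F] that] by simp
  have "(\<lambda>n. ((F ^^ k) (F (Z n)) - (F ^^ k) (F (W n))) /\<^sub>R t n) \<longlonglongrightarrow> cocycle_pow F F' k (F z) (F' z v)"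
    by (intro Suc.IH F_lim C1_difference_quotient[OF F'] Suc.prems)
  then show ?case
    by (simp add: funpow_Suc_right del: funpow.simps)
qed simp

text \<open>
  A limit of difference quotients of points ordered by \<open>\<theta>\<close> stays in the right half plane under
  all iterates, because the order is preserved by all iterates.
\<close>

lemma paratingent_cone_subset:
  assumes M: "f ` M = M"
    and order: "\<And>z w. annulus_proj z \<in> M \<Longrightarrow> annulus_proj w \<in> M
        \<Longrightarrow> fst z < fst w \<longleftrightarrow> fst (F z) < fst (F w)"
    and v: "v \<in> paratingent_cone M x"
  defines "K \<equiv> positive_cone f (inv f) (annulus_deriv f) (annulus_deriv (inv f)) x"
  shows "v \<in> K \<or> - v \<in> K"
proof -
  obtain z where x: "x = annulus_proj z"
    by (rule annulus_proj_surj)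
  obtain X Y t where XY: "\<And>n. X n \<in> M" "\<And>n. Y n \<in> M" "\<And>n. t n > 0" "X \<longlonglongrightarrow> x" "Y \<longlonglongrightarrow> x"
    and lim: "(\<lambda>n. annulus_diff (X n) (Y n) /\<^sub>R t n) \<longlonglongrightarrow> v"
    using v unfolding paratingent_cone_def by blast
  define Z W where "Z n = z + annulus_diff (X n) (annulus_proj z)"
    and "W n = z + annulus_diff (Y n) (annulus_proj z)" for n
  have Z: "Z \<longlonglongrightarrow> z" "annulus_proj (Z n) = X n" and W: "W \<longlonglongrightarrow> z" "annulus_proj (W n) = Y n" for n
    using lift_tendsto[of X z] lift_tendsto[of Y z] XY(4,5)
    by (simp_all add: Z_def[abs_def] W_def[abs_def] x annulus_proj_add_diff)
  have "(\<lambda>n. \<bar>fst (Z n) - fst (W n)\<bar>) \<longlonglongrightarrow> \<bar>fst z - fst z\<bar>"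
    by (intro tendsto_intros Z W)
  then have "\<forall>\<^sub>F n in sequentially. \<bar>fst (Z n) - fst (W n)\<bar> < 1 / 2"
    by (rule order_tendstoD) simp
  then have "\<forall>\<^sub>F n in sequentially. annulus_diff (X n) (Y n) /\<^sub>R t n = (Z n - W n) /\<^sub>R t n"
  proof eventually_elim
    case (elim n)
    then show ?case
      using annulus_diff_proj[of "Z n" "W n"] Z(2) W(2) by simp
  qed
  \<comment> \<open>Eventually the lifted points are less than half a turn apart, where
    \<open>annulus_diff\<close> is the plain difference of the lifts.\<close>
  then have quot: "(\<lambda>n. (Z n - W n) /\<^sub>R t n) \<longlonglongrightarrow> v"
    by (rule Lim_transform_eventually[OF lim])
  have quot': "(\<lambda>n. (W n - Z n) /\<^sub>R t n) \<longlonglongrightarrow> - v"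
    using tendsto_minus[OF quot] by (simp add: algebra_simps)
  \<comment> \<open>Which lift lies to the right may change with \<open>n\<close>, but one of the
    two orders occurs infinitely often. Infinitely many indices suffice to fix the sign of a limit,
    and the other order yields \<open>- v\<close>.\<close>
  have in_K: "u \<in> K"
    if Z: "Z \<longlonglongrightarrow> z" "\<And>n. annulus_proj (Z n) \<in> M" and W: "W \<longlonglongrightarrow> z" "\<And>n. annulus_proj (W n) \<in> M"
      and quot: "(\<lambda>n. (Z n - W n) /\<^sub>R t n) \<longlonglongrightarrow> u"
      and freq: "\<exists>\<^sub>F n in sequentially. fst (W n) \<le> fst (Z n)" for Z W u
  proof -
    have nonneg: "0 \<le> fst l"
      if "(\<lambda>n. (H (Z n) - H (W n)) /\<^sub>R t n) \<longlonglongrightarrow> l" "\<And>n. fst (W n) \<le> fst (Z n)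
          \<Longrightarrow> fst (H (W n)) \<le> fst (H (Z n))"
      for H :: "real \<times> real \<Rightarrow> real \<times> real" and l
    proof (rule ccontr)
      assume "\<not> 0 \<le> fst l"
      then have "\<forall>\<^sub>F n in sequentially. fst ((H (Z n) - H (W n)) /\<^sub>R t n) < 0"
        using order_tendstoD(2)[OF tendsto_fst[OF that(1)], of 0] by simp
      then have "\<forall>\<^sub>F n in sequentially. \<not> fst (W n) \<le> fst (Z n)"
      proof eventually_elim
        case (elim n)
        then have "fst (H (Z n)) < fst (H (W n))"
          using XY(3)[of n] by (simp add: mult_less_0_iff)
        then show ?case
          using that(2)[of n] by linarith
      qed
      then show False
        using freq by (simp add: frequently_def)
    qed
    have "0 \<le> fst (cocycle_pow F F' k z u)" for k
      by (rule nonneg[OF pow_difference_quotient[OF Z(1) W(1) quot]])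
        (use ordered_pow[OF M order Z(2) W(2)] in blast)
    moreover have "0 \<le> fst (cocycle_pow G G' k z u)" for k
      by (rule nonneg[OF annulus_lift.pow_difference_quotient[OF annulus_lift_inv Z(1) W(1) quot]])
        (use ordered_pow[OF M order Z(2) W(2)] in blast)
    ultimately show ?thesis
      by (simp add: K_def positive_cone_def x cocycle_pow_annulus[OF lift_F F'(1)]
          cocycle_pow_annulus[OF lift_G G'(1)])
  qed
  have "(\<exists>\<^sub>F n in sequentially. fst (W n) \<le> fst (Z n)) \<or> (\<exists>\<^sub>F n in sequentially. fst (Z n)
      \<le> fst (W n))"
    unfolding frequently_disj_iff[symmetric] by (rule eventually_frequently) (auto intro:
        always_eventually)
  then show ?thesis
    using in_K[OF Z(1) _ W(1) _ quot] in_K[OF W(1) _ Z(1) _ quot'] Z(2) W(2) XY(1,2) by auto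
qed

lemma positive_twist_regular:
  assumes M: "compact M" "M \<noteq> {}" "f ` M = M" and twist: "\<And>z. 0 < fst (F' z (0, 1))"
    and order: "\<And>z w. annulus_proj z \<in> M \<Longrightarrow> annulus_proj w \<in> M
        \<Longrightarrow> fst z < fst w \<longleftrightarrow> fst (F z) < fst (F w)"
    and minimal: "\<And>N. N \<subseteq> M \<Longrightarrow> closed N \<Longrightarrow> N \<noteq> {} \<Longrightarrow> f ` N = N \<Longrightarrow> N = M"
    and not_hyperbolic: "\<not> hyperbolic_cocycle M f (inv f) (annulus_deriv f) (annulus_deriv (inv f))"
  shows "\<exists>R. gdelta_in (top_of_set M) R \<and> M \<subseteq> closure R \<and> (\<forall>x\<in>R. C1_regular_at M x)"
proof -
  obtain R where R: "gdelta_in (top_of_set M) R" "M \<subseteq> closure R"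
    and line: "\<And>x. x \<in> R \<Longrightarrow> \<exists>D. subspace D \<and> dim D = 1 \<and>
      positive_cone f (inv f) (annulus_deriv f) (annulus_deriv (inv f)) x \<subseteq> D"
    using twist_cocycle.hyperbolic_or_regular[OF twist_cocycle[OF M twist] minimal] not_hyperbolic
        by blast
  have "C1_regular_at M x" if x: "x \<in> R" for x
  proof -
    obtain D where D: "subspace D" "dim D = 1"
      "positive_cone f (inv f) (annulus_deriv f) (annulus_deriv (inv f)) x \<subseteq> D"
      using line[OF x] by blast
    have "v \<in> D" if "v \<in> paratingent_cone M x" for v
      using paratingent_cone_subset[OF M(3) order that] D(1,3) subspace_neg[of D "- v"] by auto
    then show ?thesis
      unfolding C1_regular_at_def using D(1,2) by blast
  qed
  then show ?thesis
    using R by blast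
qed

end

lemma annulus_C1_map_lift:
  assumes "annulus_C1_map f"
  obtains F and F' :: "real \<times> real \<Rightarrow> (real \<times> real) \<Rightarrow>\<^sub>L (real \<times> real)"
  where "is_lift F f" "\<And>z. (F has_derivative F' z) (at z)" "continuous_on UNIV F'"
proof -
  obtain F where F: "is_lift F f" "C1_map F"
    using assms unfolding annulus_C1_map_def by blast
  obtain F' :: "real \<times> real \<Rightarrow> (real \<times> real) \<Rightarrow>\<^sub>L (real \<times> real)"
    where F': "\<forall>z. (F has_derivative F' z) (at z)" "continuous_on UNIV F'"
    using F(2) unfolding C1_map_def by (elim exE conjE)
  show thesis
    by (rule that[OF F(1) F'(1)[rule_format] F'(2)])
qed

lemma annulus_C1_diffeo_lift:
  assumes "annulus_C1_diffeo f" "exact_symplectic f"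
  obtains F G F' G' where "annulus_lift f F G F' G'"
proof -
  have bij: "bij f"
    using assms(1) by (simp add: annulus_C1_diffeo_def)
  obtain F F' where F: "is_lift F f" "\<And>z. (F has_derivative blinfun_apply (F' z)) (at z)"
      "continuous_on UNIV F'"
    using annulus_C1_map_lift[of f] assms(1) unfolding annulus_C1_diffeo_def by metis
  obtain G0 G0' where G0: "is_lift G0 (inv f)"
      "\<And>z. (G0 has_derivative blinfun_apply (G0' z)) (at z)" "continuous_on UNIV G0'"
    using annulus_C1_map_lift[of "inv f"] assms(1) unfolding annulus_C1_diffeo_def by metis
  have comp: "is_lift (\<lambda>z. H (K z)) id" if "is_lift H h" "is_lift K k" "\<And>x. h (k x) = x" for H K h k
    unfolding is_lift_def
  proof (intro conjI allI)
    show "continuous_on UNIV (\<lambda>z. H (K z))"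
      by (rule continuous_on_compose2[OF is_lift_continuous[OF that(1)] is_lift_continuous[OF
          that(2)] subset_UNIV])
    show "annulus_proj (H (K z)) = id (annulus_proj z)" for z
      by (simp only: is_lift_apply[OF that(1)] is_lift_apply[OF that(2)] that(3) id_apply)
  qed
  have id: "is_lift (\<lambda>z. z) id"
    by (simp add: is_lift_def)
  have f_inv: "f (inv f x) = x" "inv f (f x) = x" for x
    using bij by (simp_all add: bij_def surj_f_inv_f)
  \<comment> \<open>The composite lifts the identity, hence is an integer translation;
    \<open>G\<close> absorbs it.\<close>
  obtain j where j: "\<And>z. F (G0 z) = z + (of_int j, 0)"
    using is_lift_unique[OF id comp[OF F(1) G0(1) f_inv(1)]] by blast
  define G where "G z = G0 (z - (of_int j, 0))" for z
  define G' where "G' z = G0' (z - (of_int j, 0))" for z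
  have FG: "F (G z) = z" for z
    by (simp add: G_def j)
  have "annulus_proj (G z) = inv f (annulus_proj z)" for z
  proof -
    have "annulus_proj (z - (of_int j, 0)) = annulus_proj z"
      unfolding annulus_proj_eq_iff by (rule exI[of _ "- j"]) (simp add: prod_eq_iff)
    then show ?thesis
      by (simp add: G_def is_lift_apply[OF G0(1)])
  qed
  moreover have "continuous_on UNIV (\<lambda>z :: real \<times> real. z - (of_int j, 0))"
    by (intro continuous_intros)
  then have "continuous_on UNIV G"
    unfolding G_def[abs_def]
    by (rule continuous_on_compose2[OF is_lift_continuous[OF G0(1)] _ subset_UNIV])
  ultimately have lift_G: "is_lift G (inv f)"
    by (simp add: is_lift_def)
  \<comment> \<open>The other composite is a translation as well, which makes \<open>F\<close>
    injective; a right inverse of an injective map is also a left inverse.\<close>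
  have inj: "F z = F w \<Longrightarrow> z = w" for z w
  proof -
    assume eq: "F z = F w"
    obtain i where i: "\<And>z. G (F z) = z + (of_int i, 0)"
      using is_lift_unique[OF id comp[OF lift_G F(1) f_inv(2)]] by blast
    have "z + (of_int i, 0) = w + (of_int i, 0)"
      using i[of z] i[of w] unfolding eq by (rule trans[OF sym])
    then show "z = w"
      by (rule add_right_imp_eq)
  qed
  have "annulus_lift f F G F' G'"
  proof
    show "(G has_derivative blinfun_apply (G' z)) (at z)" for z
    proof -
      have "((\<lambda>z. z - (of_int j, 0)) has_derivative (\<lambda>v. v)) (at z)"
        by (auto intro!: derivative_eq_intros)
      then show ?thesis
        unfolding G_def[abs_def] G'_def by (rule has_derivative_compose[OF _ G0(2)])
    qed
    show "continuous_on UNIV G'"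
      unfolding G'_def[abs_def]
      by (rule continuous_on_compose2[OF G0(3) _ subset_UNIV, of UNIV "\<lambda>z. z - (of_int j, 0)"])
        (intro continuous_intros)
    show "G (F z) = z" for z
      by (rule inj) (rule FG)
    show "jacobian (F' z) = 1" for z
      by (rule exact_symplectic_jacobian[OF assms(2) F])
  qed (fact bij F lift_G FG)+
  then show thesis
    by (rule that)
qed

section \<open>Aubry-Mather sets\<close>

text \<open>The order condition passes to subsets, so minimality among ordered sets is minimality of
  the dynamics on \<open>M\<close>.\<close>

lemma aubry_mather_set_minimal:
  assumes M: "aubry_mather_set f M" and N: "N \<subseteq> M" "closed N" "N \<noteq> {}" "f ` N = N"
  shows "N = M"
proof -
  have ord: "ordered_set f M"
    using M by (simp add: aubry_mather_set_def)
  have "compact N"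
    using compact_Int_closed[of M N] ord N(1,2) by (simp add: ordered_set_def Int_absorb1)
  moreover have "\<forall>F. is_lift F f \<longrightarrow> (\<forall>z \<in> annulus_proj -` N. \<forall>z' \<in> annulus_proj -` N.
      fst z < fst z' \<longleftrightarrow> fst (F z) < fst (F z'))"
    using ord vimage_mono[OF N(1), of annulus_proj] unfolding ordered_set_def by (meson subsetD)
  ultimately have "ordered_set f N"
    unfolding ordered_set_def using N(3,4) by (intro conjI)
  then show ?thesis
    using M N(1) unfolding aubry_mather_set_def by blast
qed

text \<open>By minimality it is enough that the support is a nonempty closed invariant subset of
  \<open>M\<close>. If it were empty, finitely many null open sets would cover \<open>M\<close>;
  invariance holds because \<open>f\<close> is a homeomorphism preserving the measure.\<close>

lemma mather_measure_support:
  assumes f: "continuous_on UNIV f" "continuous_on UNIV (inv f)" "bij f"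
    and M: "aubry_mather_set f M" and \<mu>: "invariant_probability_on f M \<mu>"
  shows "measure_support \<mu> = M"
proof -
  have sets: "sets \<mu> = sets borel" and inv: "distr \<mu> borel f = \<mu>" and full: "emeasure \<mu> M = 1"
    and prob: "prob_space \<mu>"
    using \<mu> by (simp_all add: invariant_probability_on_def)
  have compact: "compact M"
    using M by (simp add: aubry_mather_set_def ordered_set_def)
  define S where "S = measure_support \<mu>"
  have space: "space \<mu> = UNIV"
    using sets_eq_imp_space_eq[OF sets] by simp
  have open_sets: "U \<in> sets \<mu>" if "open U" for U
    using that by (simp add: sets)
  have preimage: "emeasure \<mu> (f -` U) = emeasure \<mu> U" if U: "open U" for U
  proof -
    have "f \<in> measurable \<mu> borel"
      using borel_measurable_continuous_onI[OF f(1)] by (simp cong: measurable_cong_sets add: sets)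
    then have "emeasure (distr \<mu> borel f) U = emeasure \<mu> (f -` U \<inter> space \<mu>)"
      using U by (intro emeasure_distr) auto
    then show ?thesis
      by (simp add: inv space)
  qed
  have null: "emeasure \<mu> (- M) = 0"
  proof -
    have "emeasure \<mu> (space \<mu> - M) = emeasure \<mu> (space \<mu>) - emeasure \<mu> M"
      using compact by (intro emeasure_compl) (simp_all add: sets full compact_imp_closed
          borel_closed)
    then show ?thesis
      by (simp add: space full prob_space.emeasure_space_1[OF prob, unfolded space]
          Compl_eq_Diff_UNIV)
  qed
  have "S \<subseteq> M"
  proof (rule ccontr)
    assume "\<not> S \<subseteq> M"
    then obtain x where "x \<in> S" "x \<in> - M"
      by blast
    moreover have "open (- M)"
      using compact_imp_closed[OF compact] by (simp add: open_Compl)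
    ultimately have "0 < emeasure \<mu> (- M)"
      unfolding S_def measure_support_def by blast
    with null show False
      by simp
  qed
  moreover have "closed S"
  proof -
    have "- S = \<Union>{U. open U \<and> emeasure \<mu> U = 0}"
      by (auto simp: S_def measure_support_def zero_less_iff_neq_zero)
    then have "open (- S)"
      by (metis (no_types, lifting) mem_Collect_eq open_Union)
    then show ?thesis
      by (simp add: closed_def)
  qed
  moreover have "S \<noteq> {}"
  proof
    assume "S = {}"
    then have "\<forall>x. \<exists>U. open U \<and> x \<in> U \<and> emeasure \<mu> U = 0"
      by (auto simp: S_def measure_support_def zero_less_iff_neq_zero)
    then obtain U where U: "\<And>x. open (U x)" "\<And>x. x \<in> U x" "\<And>x. emeasure \<mu> (U x) = 0"
      by metis
    obtain T where T: "T \<subseteq> M" "finite T" "M \<subseteq> (\<Union>x\<in>T. U x)"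
      using compactE_image[OF compact, of M U] U(1,2) by blast
    have "emeasure \<mu> M \<le> emeasure \<mu> (\<Union>x\<in>T. U x)"
      using T(3) U(1) by (intro emeasure_mono open_sets) auto
    also have "(\<Union>x\<in>T. U x) \<in> null_sets \<mu>"
      by (rule null_sets_UN'[OF countable_finite[OF T(2)]]) (simp add: null_sets_def U open_sets)
    then have "emeasure \<mu> (\<Union>x\<in>T. U x) = 0"
      by blast
    finally show False
      by (simp add: full)
  qed
  moreover have "f ` S = S"
  proof -
    have S_iff: "f x \<in> S \<longleftrightarrow> x \<in> S" for x
    proof
      assume x: "f x \<in> S"
      show "x \<in> S"
        unfolding S_def measure_support_def
      proof (intro CollectI allI impI, elim conjE)
        fix U assume U: "open U" "x \<in> U"
        have "f ` U = inv f -` U"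
          using f(3) by (simp add: bij_vimage_eq_inv_image bij_imp_bij_inv inv_inv_eq)
        then have fU: "open (f ` U)"
          using f(2) U(1) by (simp add: open_vimage)
        then have "0 < emeasure \<mu> (f ` U)"
          using x U(2) unfolding S_def measure_support_def by blast
        moreover have "f -` (f ` U) = U"
          using f(3) by (simp add: bij_is_inj inj_vimage_image_eq)
        ultimately show "0 < emeasure \<mu> U"
          using preimage[OF fU] by simp
      qed
    next
      assume x: "x \<in> S"
      show "f x \<in> S"
        unfolding S_def measure_support_def
      proof (intro CollectI allI impI, elim conjE)
        fix U assume U: "open U" "f x \<in> U"
        have "open (f -` U)"
          using f(1) U(1) by (simp add: open_vimage)
        then have "0 < emeasure \<mu> (f -` U)"
          using x U(2) unfolding S_def measure_support_def by blast
        then show "0 < emeasure \<mu> U"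
          using preimage[OF U(1)] by simp
      qed
    qed
    have "y \<in> f ` S" if "y \<in> S" for y
      using that S_iff[of "inv f y"] f(3) by (metis bij_inv_eq_iff image_eqI)
    then show ?thesis
      using S_iff by blast
  qed
  ultimately have "S = M"
    by (intro aubry_mather_set_minimal[OF M])
  then show ?thesis
    by (simp add: S_def)
qed

theorem proposition5:
  fixes f :: "annulus \<Rightarrow> annulus" and \<mu> :: "annulus measure" and M :: "annulus set"
  assumes "twist_map f" and "exact_symplectic f"
    and "irrational_mather_measure f \<mu>"
    and "M = measure_support \<mu>"
    and "0 \<notin> lyapunov_exponents f \<mu>"
    and "\<not> uniformly_hyperbolic f M"
  shows "\<exists>G. gdelta_in (top_of_set M) G \<and> M \<subseteq> closure G \<and> (\<forall>x\<in>G. C1_regular_at M x)"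
proof -
  have diffeo: "annulus_C1_diffeo f"
  proof (cases "positive_twist_map f")
    case False
    then have "bij f" "annulus_C1_diffeo (inv f)"
      using assms(1) by (auto simp: twist_map_def negative_twist_map_def positive_twist_map_def)
    then show ?thesis
      by (simp add: annulus_C1_diffeo_def inv_inv_eq)
  qed (simp add: positive_twist_map_def)
  obtain F G F' G' where lift: "annulus_lift f F G F' G'"
    using annulus_C1_diffeo_lift[OF diffeo assms(2)] by blast
  interpret annulus_lift f F G F' G'
    by (rule lift)
  interpret inv: annulus_lift "inv f" G F G' F'
    by (rule annulus_lift_inv)
  obtain M' where M': "aubry_mather_set f M'" "invariant_probability_on f M' \<mu>"
    using assms(3) unfolding irrational_mather_measure_def by blast
  have "M = M'"
    using mather_measure_support[OF continuous_f inv.continuous_f bij M'] assms(4) by simp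
  then have am: "aubry_mather_set f M"
    using M'(1) by simp
  then have M: "compact M" "M \<noteq> {}" "f ` M = M"
    and order: "\<And>z w. annulus_proj z \<in> M \<Longrightarrow> annulus_proj w \<in> M
        \<Longrightarrow> fst z < fst w \<longleftrightarrow> fst (F z) < fst (F w)"
    using lift_F unfolding aubry_mather_set_def ordered_set_def by auto
  have inv_image: "inv f ` N = N \<longleftrightarrow> f ` N = N" for N
    using bij by (metis bij_is_inj bij_is_surj image_inv_f_f image_f_inv_f)
  have inv_order: "fst z < fst w \<longleftrightarrow> fst (G z) < fst (G w)"
      if "annulus_proj z \<in> M" "annulus_proj w \<in> M" for z w
    using order[of "G z" "G w"] that by (simp add: f_M_iff[OF M(3)] FG)
  have not_hyperbolic: "\<not> hyperbolic_cocycle M f (inv f) (annulus_deriv f) (annulus_deriv (inv f))"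
    using uniformly_hyperbolic[OF M(1,3)] assms(6) by blast
  show ?thesis
  proof (cases "positive_twist_map f")
    case True
    show ?thesis
      by (rule positive_twist_regular[OF M positive_twist_deriv_pos[OF True lift_F F'(1)] order
            aubry_mather_set_minimal[OF am] not_hyperbolic])
  next
    case False
    \<comment> \<open>The conclusion concerns only the set \<open>M\<close>, so it may be proved
      with \<open>inv f\<close> in place of \<open>f\<close>. Order, minimality and failure of
      hyperbolicity are all invariant under this exchange.\<close>
    then have twist: "positive_twist_map (inv f)"
      using assms(1) by (simp add: twist_map_def negative_twist_map_def)
    have "\<not> hyperbolic_cocycle M (inv f) (inv (inv f)) (annulus_deriv (inv f)) (annulus_deriv (inv
        (inv f)))"
      using not_hyperbolic hyperbolic_cocycle_swap unfolding inv_inv_eq[OF bij] by blast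
    moreover have "inv f ` M = M"
      using M(3) inv_image by simp
    moreover have "N = M" if "N \<subseteq> M" "closed N" "N \<noteq> {}" "inv f ` N = N" for N
      using that inv_image[of N] by (intro aubry_mather_set_minimal[OF am]) auto
    ultimately show ?thesis
      by (intro inv.positive_twist_regular[OF M(1,2) _ positive_twist_deriv_pos[OF twist lift_G
          G'(1)] inv_order])
  qed
qed

end
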